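(* Assume $\mathrm{cf}(\kappa)=\omega$. Then $\mathbb{P}$ (equivalently, its regular open completion $\mathbb{B}$) satisfies the $(\omega,\nu)$-distributive law for every cardinal $\nu<\kappa$; that is, forcing with $\mathbb{P}$ adds no new function from $\omega$ into $\nu$, for any $\nu<\kappa$.
   Context: $\kappa$ is a singular cardinal and $\langle \kappa_\alpha:\alpha<\mathrm{cf}(\kappa)\rangle$ is a strictly increasing sequence of regular cardinals with supremum $\kappa$ such that $\mathrm{cf}(\kappa)<\kappa_\alpha<\kappa$ for all $\alpha$. Standing assumption: $\mu^{\mathrm{cf}(\kappa)}<\kappa$ for every cardinal $\mu<\kappa$. Let $N$ be the set of functions $t$ with $\mathrm{dom}(t)$ an ordinal $<\mathrm{cf}(\kappa)$ and $t(\alpha)<\kappa_\alpha$ for all $\alpha\in\mathrm{dom}(t)$, and $X$ the set of functions $f$ with domain $\mathrm{cf}(\kappa)$ and $f(\alpha)<\kappa_\alpha$ for all $\alpha$. A tree is a subset $T\subseteq N$ closed under initial segments; $[T]=\{f\in X: f\restriction\alpha\in T\text{ for all }\alpha<\mathrm{cf}(\kappa)\}$; $\mathrm{Succ}_T(t)$ is the set of children of $t$ in $T$ (one-point extensions of $t$ in $T$). $T$ is non-stopping if it is nonempty and every $t\in T$ has an extension in $[T]$; $T$ is suitable if it is non-stopping and every maximal element of $T\cup[T]$ (under extension) lies in $[T]$. $T$ is perfect if it is suitable and for every $\alpha<\mathrm{cf}(\kappa)$ and every $t\in T$ there is $t'\in T$ extending $t$ with $|\mathrm{Succ}_T(t')|\ge\kappa_\alpha$.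 $\mathbb{P}$ is the set of perfect trees ordered by inclusion, and $\mathbb{B}$ its regular open completion. A complete Boolean algebra satisfies the $(\lambda,\mu)$-distributive law iff every family of $\lambda$ maximal antichains each of size $\le\mu$ has a common nonzero refinement, equivalently forcing adds no new function $\lambda\to\mu$. *)

theory Defs
  imports "HOL-Analysis.Abstract_Topology"
begin

unbundle cardinal_syntax

section \<open>Cardinals\<close>

text \<open>A cardinal is a relation \<open>r\<close> with \<open>Card_order r\<close>, that is, an initial ordinal.
  The ordinals below \<open>r\<close> are the elements of \<open>Field r\<close>; an element \<open>x\<close> of \<open>Field r\<close>, regarded as
  an ordinal, is the well-order \<open>seg r x\<close> on its set \<open>underS r x\<close> of predecessors.\<close>

definition seg :: "'a rel \<Rightarrow> 'a \<Rightarrow> 'a rel" where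
  "seg r x = Restr r (underS r x)"

definition regular_cardinal :: "'a rel \<Rightarrow> bool" where
  "regular_cardinal r \<longleftrightarrow> Card_order r \<and> infinite (Field r) \<and> regularCard r"

definition singular_cardinal :: "'a rel \<Rightarrow> bool" where
  "singular_cardinal r \<longleftrightarrow> Card_order r \<and> infinite (Field r) \<and> \<not> regularCard r"

definition has_cofinality :: "'a rel \<Rightarrow> 'c rel \<Rightarrow> bool" where
  "has_cofinality r c \<longleftrightarrow>
     Card_order c \<and>
     (\<exists>A. A \<subseteq> Field r \<and> cofinal A r \<and> |A| =o c) \<and>
     (\<forall>A. A \<subseteq> Field r \<and> cofinal A r \<longrightarrow> c \<le>o |A| )"

section \<open>Trees\<close>

text \<open>The index type \<open>'i\<close> plays the role of the ordinal \<open>cf(\<kappa>)\<close>, so that the ordinals below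
  \<open>cf(\<kappa>)\<close> are its elements and \<open>{..<\<alpha>}\<close> is the ordinal \<open>\<alpha>\<close> as a set; for countable cofinality
  it is \<open>nat\<close>. Set-theoretic functions are partial maps, restriction is \<open>|`\<close>, and extension is
  \<open>\<subseteq>\<^sub>m\<close>. The cardinal \<open>\<kappa>\<^sub>\<alpha>\<close> is \<open>seg \<kappa> (k \<alpha>)\<close>, and \<open>x < \<kappa>\<^sub>\<alpha>\<close> is \<open>x \<in> underS \<kappa> (k \<alpha>)\<close>.\<close>

definition nodes :: "'a rel \<Rightarrow> ('i::wellorder \<Rightarrow> 'a) \<Rightarrow> ('i \<rightharpoonup> 'a) set" where
  "nodes \<kappa> k = {t. (\<exists>\<alpha>. dom t = {..<\<alpha>}) \<and> (\<forall>\<alpha> x. t \<alpha> = Some x \<longrightarrow> x \<in> underS \<kappa> (k \<alpha>))}"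

definition full_branches :: "'a rel \<Rightarrow> ('i::wellorder \<Rightarrow> 'a) \<Rightarrow> ('i \<rightharpoonup> 'a) set" where
  "full_branches \<kappa> k = {f. dom f = UNIV \<and> (\<forall>\<alpha> x. f \<alpha> = Some x \<longrightarrow> x \<in> underS \<kappa> (k \<alpha>))}"

definition is_tree :: "'a rel \<Rightarrow> ('i::wellorder \<Rightarrow> 'a) \<Rightarrow> ('i \<rightharpoonup> 'a) set \<Rightarrow> bool" where
  "is_tree \<kappa> k T \<longleftrightarrow> T \<subseteq> nodes \<kappa> k \<and> (\<forall>t\<in>T. \<forall>\<alpha>. t |` {..<\<alpha>} \<in> T)"

definition branches :: "'a rel \<Rightarrow> ('i::wellorder \<Rightarrow> 'a) \<Rightarrow> ('i \<rightharpoonup> 'a) set \<Rightarrow> ('i \<rightharpoonup> 'a) set" where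
  "branches \<kappa> k T = {f \<in> full_branches \<kappa> k. \<forall>\<alpha>. f |` {..<\<alpha>} \<in> T}"

definition succs :: "('i::wellorder \<rightharpoonup> 'a) set \<Rightarrow> ('i \<rightharpoonup> 'a) \<Rightarrow> ('i \<rightharpoonup> 'a) set" where
  "succs T t = {t' \<in> T. \<exists>\<alpha> x. dom t = {..<\<alpha>} \<and> t' = t(\<alpha> \<mapsto> x)}"

definition non_stopping :: "'a rel \<Rightarrow> ('i::wellorder \<Rightarrow> 'a) \<Rightarrow> ('i \<rightharpoonup> 'a) set \<Rightarrow> bool" where
  "non_stopping \<kappa> k T \<longleftrightarrow> T \<noteq> {} \<and> (\<forall>t\<in>T. \<exists>f\<in>branches \<kappa> k T. t \<subseteq>\<^sub>m f)"

definition suitable :: "'a rel \<Rightarrow> ('i::wellorder \<Rightarrow> 'a) \<Rightarrow> ('i \<rightharpoonup> 'a) set \<Rightarrow> bool" where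
  "suitable \<kappa> k T \<longleftrightarrow> non_stopping \<kappa> k T \<and>
     (\<forall>m \<in> T \<union> branches \<kappa> k T.
        (\<forall>s \<in> T \<union> branches \<kappa> k T. m \<subseteq>\<^sub>m s \<longrightarrow> s = m) \<longrightarrow> m \<in> branches \<kappa> k T)"

definition perfect :: "'a rel \<Rightarrow> ('i::wellorder \<Rightarrow> 'a) \<Rightarrow> ('i \<rightharpoonup> 'a) set \<Rightarrow> bool" where
  "perfect \<kappa> k T \<longleftrightarrow> is_tree \<kappa> k T \<and> suitable \<kappa> k T \<and>
     (\<forall>\<alpha>. \<forall>t\<in>T. \<exists>t'\<in>T. t \<subseteq>\<^sub>m t' \<and> seg \<kappa> (k \<alpha>) \<le>o |succs T t'| )"

definition perfect_trees :: "'a rel \<Rightarrow> ('i::wellorder \<Rightarrow> 'a) \<Rightarrow> ('i \<rightharpoonup> 'a) set set" where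
  "perfect_trees \<kappa> k = {T. perfect \<kappa> k T}"

section \<open>Forcing\<close>

text \<open>All partial orders below are families \<open>Q\<close> of sets ordered by inclusion, smaller
  conditions being stronger.\<close>

definition compatible :: "'b set set \<Rightarrow> 'b set \<Rightarrow> 'b set \<Rightarrow> bool" where
  "compatible Q p q \<longleftrightarrow> (\<exists>r\<in>Q. r \<subseteq> p \<and> r \<subseteq> q)"

definition antichain :: "'b set set \<Rightarrow> 'b set set \<Rightarrow> bool" where
  "antichain Q A \<longleftrightarrow> A \<subseteq> Q \<and> (\<forall>p\<in>A. \<forall>q\<in>A. p \<noteq> q \<longrightarrow> \<not> compatible Q p q)"

definition maximal_antichain :: "'b set set \<Rightarrow> 'b set set \<Rightarrow> bool" where
  "maximal_antichain Q A \<longleftrightarrow> antichain Q A \<and> (\<forall>A'. antichain Q A' \<and> A \<subseteq> A' \<longrightarrow> A' = A)"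

definition refines :: "'b set set \<Rightarrow> 'b set set \<Rightarrow> bool" where
  "refines R W \<longleftrightarrow> (\<forall>r\<in>R. \<exists>w\<in>W. r \<subseteq> w)"

text \<open>The \<open>(|L|, \<mu>)\<close>-distributive law. For a Boolean algebra, \<open>Q\<close> is its set of nonzero elements,
  so that maximal antichains are the partitions of unity.\<close>

definition distributive_law :: "'l set \<Rightarrow> 'c rel \<Rightarrow> 'b set set \<Rightarrow> bool" where
  "distributive_law L \<mu> Q \<longleftrightarrow>
     (\<forall>W. (\<forall>l\<in>L. maximal_antichain Q (W l) \<and> |W l| \<le>o \<mu>) \<longrightarrow>
          (\<exists>R. maximal_antichain Q R \<and> (\<forall>l\<in>L. refines R (W l))))"

definition down_topology :: "'b set set \<Rightarrow> 'b set topology" where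
  "down_topology P = topology (\<lambda>U. U \<subseteq> P \<and> (\<forall>p\<in>U. \<forall>q\<in>P. q \<subseteq> p \<longrightarrow> q \<in> U))"

lemma openin_down_topology:
  "openin (down_topology P) U \<longleftrightarrow> U \<subseteq> P \<and> (\<forall>p\<in>U. \<forall>q\<in>P. q \<subseteq> p \<longrightarrow> q \<in> U)"
proof -
  have "istopology (\<lambda>U. U \<subseteq> P \<and> (\<forall>p\<in>U. \<forall>q\<in>P. q \<subseteq> p \<longrightarrow> q \<in> U))"
    unfolding istopology_def by blast
  then show ?thesis
    by (simp add: down_topology_def)
qed

definition regular_open_algebra :: "'b set set \<Rightarrow> 'b set set set" where
  "regular_open_algebra P =
     {U. down_topology P interior_of (down_topology P closure_of U) = U}"

text \<open>A \<open>P\<close>-name for a relation between the ground-model sets \<open>L\<close> and \<open>A\<close> is a set \<open>F\<close> of pairs of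
  a condition and an element of \<open>L \<times> A\<close> (standing for its check name); up to forced equality,
  every \<open>P\<close>-name for a function from \<open>L\<close> to \<open>A\<close> is of this form. \<open>forces_mem P F p e\<close> says that
  \<open>p\<close> forces \<open>e\<close> to belong to \<open>F\<close>.\<close>

definition forces_mem :: "'b set set \<Rightarrow> ('b set \<times> 'e) set \<Rightarrow> 'b set \<Rightarrow> 'e \<Rightarrow> bool" where
  "forces_mem P F p e \<longleftrightarrow>
     (\<forall>q\<in>P. q \<subseteq> p \<longrightarrow> (\<exists>r\<in>P. r \<subseteq> q \<and> (\<exists>s. (s, e) \<in> F \<and> r \<subseteq> s)))"

definition forces_function ::
    "'b set set \<Rightarrow> 'l set \<Rightarrow> 'c set \<Rightarrow> ('b set \<times> 'l \<times> 'c) set \<Rightarrow> 'b set \<Rightarrow> bool" where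
  "forces_function P L A F p \<longleftrightarrow>
     (\<forall>l\<in>L. \<forall>q\<in>P. q \<subseteq> p \<longrightarrow> (\<exists>r\<in>P. r \<subseteq> q \<and> (\<exists>x\<in>A. forces_mem P F r (l, x)))) \<and>
     (\<forall>q\<in>P. q \<subseteq> p \<longrightarrow> (\<forall>l x y. forces_mem P F q (l, x) \<and> forces_mem P F q (l, y) \<longrightarrow> x = y))"

definition adds_no_new_function :: "'b set set \<Rightarrow> 'l set \<Rightarrow> 'c set \<Rightarrow> bool" where
  "adds_no_new_function P L A \<longleftrightarrow>
     (\<forall>F. \<forall>p\<in>P. F \<subseteq> P \<times> (L \<times> A) \<and> forces_function P L A F p \<longrightarrow>
        (\<exists>q\<in>P. q \<subseteq> p \<and> (\<exists>g. \<forall>l\<in>L. g l \<in> A \<and> forces_mem P F q (l, g l))))"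

end

theory Submission
  imports Defs
begin

text \<open>
  Given \<open>\<nu> < \<kappa>\<close>, fix \<open>e\<close> with \<open>\<nu>\<^sup>\<omega> < \<kappa>\<^sub>e\<close>. For each candidate \<open>h : \<omega> \<rightarrow> \<nu>\<close> consider a game: the position is
  a perfect tree with a stem having at least \<open>\<kappa>\<^sub>e\<^sub>+\<^sub>n\<close> children; the first player forbids fewer than
  \<open>\<kappa>\<^sub>e\<^sub>+\<^sub>n\<close> of them, and the second player picks another child and shrinks the tree above it to one that
  decides the \<open>n\<close>-th value to be \<open>h n\<close> and is a position for stage \<open>n + 1\<close>. If the first player wins all
  these games, then, as there are only \<open>\<nu>\<^sup>\<omega>\<close> of them and \<open>\<kappa>\<^sub>e\<^sub>+\<^sub>n\<close> is regular, the forbidden sets of all the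
  winning strategies can be avoided simultaneously; the values decided along such a play form an
  \<open>h\<close> whose game was not won. So for some \<open>h\<close> the second player does not lose, and the
  positions from which this is so fuse to a perfect tree forcing the whole sequence to be \<open>h\<close>.
\<close>

section \<open>The game\<close>

text \<open>A rank is a well-founded certificate that the first player wins; branching over
  all positions \<open>'p\<close>, it stands in for an ordinal rank.\<close>

datatype 'p rank = Stop | Rank "'p \<Rightarrow> 'p rank"

text \<open>\<open>Rank f\<close> certifies a first-player win against \<open>h\<close>: a child is
  forbidden when some legal answer \<open>p'\<close> above it lacks the certificate
  \<open>f p'\<close>, and fewer than \<open>r n\<close> children may be forbidden.
  \<open>Stop\<close> certifies nothing and serves as the base of the datatype.\<close>

primrec ranked ::
    "(nat \<Rightarrow> 'p set) \<Rightarrow> ('p \<Rightarrow> 'c set) \<Rightarrow> (nat \<Rightarrow> 'v \<Rightarrow> 'p \<Rightarrow> 'c \<Rightarrow> 'p \<Rightarrow> bool) \<Rightarrow>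
     (nat \<Rightarrow> 'k rel) \<Rightarrow> (nat \<Rightarrow> 'v) \<Rightarrow> 'p rank \<Rightarrow> nat \<Rightarrow> 'p \<Rightarrow> bool" where
  "ranked Pos ch step r h Stop n p = False"
| "ranked Pos ch step r h (Rank f) n p \<longleftrightarrow>
     |{c \<in> ch p. \<exists>p'\<in>Pos (Suc n). step n (h n) p c p' \<and> \<not> ranked Pos ch step r h (f p') (Suc n) p'}|
       <o r n"

text \<open>Each term is an immediate subterm of the one before. By structural induction no
  \<open>x\<close> occurs in the sequence: after \<open>Rank f\<close> would come some
  \<open>f p\<close>, which the induction hypothesis excludes.\<close>

lemma no_infinite_rank_descent:
  fixes a :: "nat \<Rightarrow> 'p rank"
  assumes "\<And>n. \<exists>f p. a n = Rank f \<and> a (Suc n) = f p"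
  shows False
proof -
  have "\<forall>n. a n \<noteq> x" for x
  proof (induction x)
    case Stop
    then show ?case using assms by (metis rank.distinct(1))
  next
    case (Rank f)
    then show ?case using assms by (metis rangeI rank.inject)
  qed
  then show False by blast
qed

text \<open>\<open>G n\<close> will consist of the positions that no rank certifies for the first
  player. If the start were certified for every \<open>h\<close>, one play could follow all
  certificates at once, and the certificate of the sequence it defines would descend
  forever.\<close>

lemma second_player_strategy:
  fixes r :: "nat \<Rightarrow> 'k rel" and Pos :: "nat \<Rightarrow> 'p set" and A :: "nat \<Rightarrow> 'v set"
  assumes reg: "\<And>n. regular_cardinal (r n)"
    and small: "\<And>n. |{h. \<forall>n. h n \<in> A n}| <o r n"
    and large: "\<And>n p. p \<in> Pos n \<Longrightarrow> r n \<le>o |ch p|"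
    and move: "\<And>n p c. p \<in> Pos n \<Longrightarrow> c \<in> ch p \<Longrightarrow> \<exists>v\<in>A n. \<exists>p'\<in>Pos (Suc n). step n v p c p'"
    and start: "p0 \<in> Pos 0"
  obtains h G where "\<And>n. h n \<in> A n" "p0 \<in> G 0" "\<And>n. G n \<subseteq> Pos n"
    "\<And>n p. p \<in> G n \<Longrightarrow> r n \<le>o |{c \<in> ch p. \<exists>p'\<in>G (Suc n). step n (h n) p c p'}|"
proof -
  let ?H = "{h. \<forall>n. h n \<in> A n}"
  let ?R = "ranked Pos ch step r"
  have "\<exists>h. (\<forall>n. h n \<in> A n) \<and> (\<forall>\<rho>. \<not> ?R h \<rho> 0 p0)"
  proof (rule ccontr)
    assume neg: "\<not> ?thesis"
    \<comment> \<open>A state holds the position, the current certificate of each candidate, and the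
      set \<open>K\<close> of candidates that agree with the values decided so far. The clause for
      \<open>n = 0\<close> records that all candidates are present at the start.\<close>
    define Inv where "Inv = (\<lambda>n (p, \<rho>, K). p \<in> Pos n \<and> K \<subseteq> ?H \<and> (n = 0 \<longrightarrow> K = {h. \<forall>i. h i \<in> A i}) \<and> (\<forall>h\<in>K. ?R h (\<rho> h) n p))"
    define Next where "Next = (\<lambda>n::nat. \<lambda>(p :: 'p, \<rho>, K) (p' :: 'p, \<rho>', K'). \<exists>v\<in>A n. K' = {h \<in> K. h n = v} \<and>
        (\<forall>h\<in>K'. \<exists>f. \<rho> h = Rank f \<and> \<rho>' h = f p'))"
    have "\<exists>x. \<forall>n. Inv n (x n) \<and> Next n (x n) (x (Suc n))"
    proof (rule dependent_nat_choice)
      obtain \<rho> where "\<And>h. (\<forall>n. h n \<in> A n) \<Longrightarrow> ?R h (\<rho> h) 0 p0"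
        using neg by metis
      then have "Inv 0 (p0, \<rho>, {h. \<forall>n. h n \<in> A n})"
        using start by (auto simp: Inv_def)
      then show "\<exists>x. Inv 0 x" by blast
    next
      fix x n assume "Inv n x"
      then obtain p \<rho> K where x: "x = (p, \<rho>, K)" and p: "p \<in> Pos n" and K: "K \<subseteq> ?H"
        and R: "\<And>h. h \<in> K \<Longrightarrow> ?R h (\<rho> h) n p"
        by (auto simp: Inv_def)
      have "\<exists>f. \<rho> h = Rank f" if "h \<in> K" for h
        using R[OF that] by (cases "\<rho> h") auto
      then obtain F where F: "\<And>h. h \<in> K \<Longrightarrow> \<rho> h = Rank (F h)" by metis
      define B where "B h =
        {c \<in> ch p. \<exists>p'\<in>Pos (Suc n). step n (h n) p c p' \<and> \<not> ?R h (F h p') (Suc n) p'}" for h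
      have B: "|B h| <o r n" if "h \<in> K" for h
        using R[OF that] F[OF that] by (simp add: B_def)
      have "|K| <o r n"
        using ordLeq_ordLess_trans[OF card_of_mono1[OF K] small] .
      then have "|\<Union>h\<in>K. B h| <o r n"
        using stable_UNION[OF regularCard_stable] reg B by (metis regular_cardinal_def)
      then have "|\<Union>h\<in>K. B h| <o |ch p|"
        using large[OF p] ordLess_ordLeq_trans by blast
      then have "\<not> ch p \<subseteq> (\<Union>h\<in>K. B h)"
        using card_of_mono1 not_ordLess_ordLeq by blast
      then obtain c where c: "c \<in> ch p" "\<And>h. h \<in> K \<Longrightarrow> c \<notin> B h" by blast
      obtain v p' where v: "v \<in> A n" "p' \<in> Pos (Suc n)" "step n v p c p'"
        using move[OF p c(1)] by blast
      let ?y = "(p', \<lambda>h. F h p', {h \<in> K. h n = v})"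
      \<comment> \<open>For a surviving \<open>h\<close> the decided value is \<open>h n\<close>, so
        the move is legal in its game; since \<open>c\<close> is not in \<open>B h\<close>, the new
        position carries the certificate \<open>F h p'\<close>.\<close>
      have "Inv (Suc n) ?y"
        using K v c by (auto simp: Inv_def B_def)
      moreover have "Next n x ?y"
        using v F by (auto simp: Next_def x)
      ultimately show "\<exists>y. Inv (Suc n) y \<and> Next n x y" by blast
    qed
    then obtain x where x: "\<And>n. Inv n (x n)" "\<And>n. Next n (x n) (x (Suc n))" by blast
    define \<rho> where "\<rho> n = fst (snd (x n))" for n
    define K where "K n = snd (snd (x n))" for n
    define Q where "Q n v p \<longleftrightarrow> v \<in> A n \<and> K (Suc n) = {h \<in> K n. h n = v} \<and>
        (\<forall>h\<in>K (Suc n). \<exists>f. \<rho> n h = Rank f \<and> \<rho> (Suc n) h = f p)" for n v p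
    have "\<exists>v p. Q n v p" for n
      using x(2)[of n] by (cases "x n"; cases "x (Suc n)") (auto simp: Q_def Next_def \<rho>_def K_def)
    then obtain v p where "\<And>n. Q n (v n) (p n)"
      by metis
    then have v: "\<And>n. v n \<in> A n" "\<And>n. K (Suc n) = {h \<in> K n. h n = v n}"
      "\<And>n h. h \<in> K (Suc n) \<Longrightarrow> \<exists>f. \<rho> n h = Rank f \<and> \<rho> (Suc n) h = f (p n)"
      unfolding Q_def by blast+
    \<comment> \<open>The sequence of decided values is itself a candidate and is never discarded,
      so its certificates form an infinite descent.\<close>
    have "v \<in> K 0"
      using x(1)[of 0] v(1) by (auto simp: Inv_def K_def)
    then have vK: "v \<in> K n" for n
      by (induction n) (auto simp: v(2))
    have "\<exists>f p. \<rho> n v = Rank f \<and> \<rho> (Suc n) v = f p" for n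
      using v(3)[OF vK] by blast
    then show False by (rule no_infinite_rank_descent)
  qed
  then obtain h where h: "\<And>n. h n \<in> A n" "\<And>\<rho>. \<not> ?R h \<rho> 0 p0" by blast
  define G where "G n = {p \<in> Pos n. \<forall>\<rho>. \<not> ?R h \<rho> n p}" for n
  have "r n \<le>o |{c \<in> ch p. \<exists>p'\<in>G (Suc n). step n (h n) p c p'}|" (is "_ \<le>o |?X|") if "p \<in> G n" for n p
  proof (rule ccontr)
    assume "\<not> r n \<le>o |?X|"
    then have X: "|?X| <o r n"
      using reg[of n] not_ordLeq_iff_ordLess[OF card_of_Well_order, of "r n"]
      by (auto simp: regular_cardinal_def card_order_on_def)
    \<comment> \<open>\<open>f\<close> picks a certificate wherever one exists. Hence the children
      forbidden by \<open>Rank f\<close> lie in \<open>?X\<close>, and a small \<open>?X\<close>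
      would make \<open>Rank f\<close> certify \<open>p\<close>.\<close>
    define f where "f p' = (SOME \<rho>. ?R h \<rho> (Suc n) p')" for p'
    have "{c \<in> ch p. \<exists>p'\<in>Pos (Suc n). step n (h n) p c p' \<and> \<not> ?R h (f p') (Suc n) p'} \<subseteq> ?X"
      unfolding G_def f_def using someI by (smt (verit) Collect_mono mem_Collect_eq)
    then have "?R h (Rank f) n p"
      using ordLeq_ordLess_trans[OF card_of_mono1 X] by simp
    then show False using that unfolding G_def by blast
  qed
  then show thesis
    using that[of h G] h start by (auto simp: G_def)
qed

section \<open>Perfect trees\<close>

lemma infinite_if_large:
  assumes "regular_cardinal r" "r \<le>o |X|"
  shows "infinite X"
  using assms
  by (metis Field_card_of card_of_Card_order cinfinite_def cinfinite_mono regular_cardinal_def)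

locale tree_forcing =
  fixes \<kappa> :: "'a rel" and k :: "nat \<Rightarrow> 'a"
  assumes regular: "\<And>n. regular_cardinal (seg \<kappa> (k n))"
    and mono: "\<And>m n. m \<le> n \<Longrightarrow> seg \<kappa> (k m) \<le>o seg \<kappa> (k n)"
begin

section \<open>Nodes as finite sequences ordered by extension\<close>

abbreviation height :: "(nat \<rightharpoonup> 'a) \<Rightarrow> nat" where
  "height t \<equiv> card (dom t)"

lemma dom_node: "t \<in> nodes \<kappa> k \<Longrightarrow> dom t = {..<height t}"
proof -
  assume "t \<in> nodes \<kappa> k"
  then obtain \<alpha> where "dom t = {..<\<alpha>}" unfolding nodes_def by blast
  then show ?thesis by simp
qed

lemma node_restrict: "t \<in> nodes \<kappa> k \<Longrightarrow> t |` {..<j} \<in> nodes \<kappa> k"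
proof -
  assume t: "t \<in> nodes \<kappa> k"
  have "dom (t |` {..<j}) = {..<min (height t) j}"
    using dom_node[OF t] by auto
  moreover have "x \<in> underS \<kappa> (k i)" if "(t |` {..<j}) i = Some x" for i x
    using t that by (cases "i < j") (simp_all add: nodes_def restrict_map_def)
  ultimately show ?thesis
    unfolding nodes_def by blast
qed

lemma node_eq_restrict:
  assumes "t \<in> nodes \<kappa> k" "t \<subseteq>\<^sub>m f"
  shows "t = f |` {..<height t}"
proof
  fix x
  show "t x = (f |` {..<height t}) x"
    using assms(2) dom_node[OF assms(1)]
    by (cases "x \<in> dom t") (auto simp: restrict_map_def map_le_def)
qed

lemma restrict_map_le: "f |` A \<subseteq>\<^sub>m f"
  by (auto simp: map_le_def restrict_map_def)

text \<open>Both nodes are initial segments of the same \<open>f\<close>, so their lengths decide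
  which extends the other.\<close>

lemma nodes_comparable:
  assumes "s \<in> nodes \<kappa> k" "t \<in> nodes \<kappa> k" "s \<subseteq>\<^sub>m f" "t \<subseteq>\<^sub>m f" "height s \<le> height t"
  shows "s \<subseteq>\<^sub>m t"
proof -
  have "dom s \<subseteq> dom t"
    using assms(5) dom_node[OF assms(1)] dom_node[OF assms(2)] by (metis lessThan_subset_iff)
  then show ?thesis using assms(3,4) unfolding map_le_def by (metis subsetD)
qed

lemma height_mono: "s \<in> nodes \<kappa> k \<Longrightarrow> t \<in> nodes \<kappa> k \<Longrightarrow> s \<subseteq>\<^sub>m t \<Longrightarrow> height s \<le> height t"
  using dom_node[of t] by (metis card_mono finite_lessThan map_le_implies_dom_le)

lemma nodes_eq:
  assumes "s \<in> nodes \<kappa> k" "t \<in> nodes \<kappa> k" "s \<subseteq>\<^sub>m f" "t \<subseteq>\<^sub>m f" "height s = height t"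
  shows "s = t"
  using nodes_comparable assms by (metis map_le_antisym order_refl)

lemma tree_node: "is_tree \<kappa> k T \<Longrightarrow> t \<in> T \<Longrightarrow> t \<in> nodes \<kappa> k"
  by (auto simp: is_tree_def)

lemma tree_down: "is_tree \<kappa> k T \<Longrightarrow> t \<in> T \<Longrightarrow> s \<in> nodes \<kappa> k \<Longrightarrow> s \<subseteq>\<^sub>m t \<Longrightarrow> s \<in> T"
  using node_eq_restrict by (metis is_tree_def)

lemma succsD:
  assumes "is_tree \<kappa> k T" "c \<in> succs T t"
  shows "c \<in> T" "t \<subseteq>\<^sub>m c" "height c = Suc (height t)"
proof -
  obtain \<alpha> x where c: "c \<in> T" "dom t = {..<\<alpha>}" "c = t(\<alpha> \<mapsto> x)"
    using assms by (auto simp: succs_def)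
  then show "c \<in> T" "height c = Suc (height t)" by auto
  have "\<alpha> \<notin> dom t" using c by simp
  then show "t \<subseteq>\<^sub>m c" using c(3) by (auto simp: map_le_def)
qed

lemma succ_between:
  assumes T: "is_tree \<kappa> k T" and s: "s \<in> T" and t: "t \<in> nodes \<kappa> k" "t \<subseteq>\<^sub>m s" "height t < height s"
  shows "\<exists>c\<in>succs T t. c \<subseteq>\<^sub>m s"
proof -
  let ?c = "s |` {..<Suc (height t)}"
  have "height t \<in> dom s"
    using t(3) dom_node[OF tree_node[OF T s]] by blast
  then obtain x where x: "s (height t) = Some x" by blast
  have "?c = t(height t \<mapsto> x)"
  proof
    fix i
    show "?c i = (t(height t \<mapsto> x)) i"
      using x node_eq_restrict[OF t(1,2)]
      by (cases "i < height t"; cases "i = height t") (auto simp: restrict_map_def dest: fun_cong[of t _ i])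
  qed
  then have "?c \<in> succs T t"
    using T s dom_node[OF t(1)] unfolding succs_def is_tree_def by blast
  then show ?thesis using restrict_map_le by blast
qed

text \<open>Choosing children repeatedly yields a branch through any node. A maximal element that is
  a node must then equal a branch extending it.\<close>

lemma suitableI:
  assumes T: "is_tree \<kappa> k T" and ne: "T \<noteq> {}" and succ: "\<And>t. t \<in> T \<Longrightarrow> succs T t \<noteq> {}"
  shows "suitable \<kappa> k T"
proof -
  have "\<exists>f\<in>branches \<kappa> k T. t \<subseteq>\<^sub>m f" if t: "t \<in> T" for t
  proof -
    have "\<exists>a. \<forall>n. (a n \<in> T \<and> (n = 0 \<longrightarrow> a n = t)) \<and> a (Suc n) \<in> succs T (a n)"
      using t succ succsD(1)[OF T] by (intro dependent_nat_choice) fastforce+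
    then obtain a where a: "\<And>n. a n \<in> T" "a 0 = t" "\<And>n. a (Suc n) \<in> succs T (a n)"
      by blast
    have node: "a n \<in> nodes \<kappa> k" for n
      using a(1) tree_node[OF T] by blast
    have height: "n \<le> height (a n)" for n
      by (induction n) (auto simp: succsD(3)[OF T a(3)])
    have chain: "a i \<subseteq>\<^sub>m a j" if "i \<le> j" for i j
      using that
    proof (induction j rule: dec_induct)
      case (step n)
      then show ?case using succsD(2)[OF T a(3)] map_le_trans by blast
    qed simp
    \<comment> \<open>The node \<open>a (Suc j)\<close> has length at least \<open>Suc j\<close>, so
      it is defined at \<open>j\<close>.\<close>
    define f where "f j = a (Suc j) j" for j
    have dom: "j \<in> dom (a (Suc j))" for j
      using dom_node[OF node[of "Suc j"]] height[of "Suc j"] by auto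
    have eq: "a i j = f j" if "j \<in> dom (a i)" for i j
    proof (cases "i \<le> Suc j")
      case True
      then show ?thesis using chain[OF True] that unfolding f_def map_le_def by blast
    next
      case False
      then have "a (Suc j) \<subseteq>\<^sub>m a i" using chain by simp
      then have "a (Suc j) j = a i j" using dom[of j] unfolding map_le_def by blast
      then show ?thesis by (simp add: f_def)
    qed
    then have le: "a i \<subseteq>\<^sub>m f" for i
      unfolding map_le_def by blast
    have "dom f = UNIV"
      using dom by (simp add: f_def set_eq_iff domIff)
    moreover have "x \<in> underS \<kappa> (k j)" if "f j = Some x" for j x
      using that node[of "Suc j"] unfolding nodes_def f_def by blast
    moreover have "f |` {..<j} \<in> T" for j
    proof -
      have "(f |` {..<j}) i = (a j |` {..<j}) i" for i
      proof (cases "i < j")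
        case True
        then have "i \<in> dom (a j)" using dom_node[OF node[of j]] height[of j] by auto
        then show ?thesis using True eq[of i j] by simp
      qed simp
      then have "f |` {..<j} = a j |` {..<j}" by blast
      then show ?thesis using T a(1) by (simp add: is_tree_def)
    qed
    ultimately have "f \<in> branches \<kappa> k T"
      by (simp add: branches_def full_branches_def)
    then show ?thesis using le[of 0] a(2) by blast
  qed
  then show ?thesis
    using ne unfolding suitable_def non_stopping_def by blast
qed

text \<open>The splitting node \<open>t'\<close> has a child, which is strictly longer than
  \<open>t\<close>; the first step from \<open>t\<close> towards it is a child of
  \<open>t\<close>.\<close>

lemma succs_ne_if_large_above:
  assumes T: "is_tree \<kappa> k T" and t: "t \<in> T" "t' \<in> T" "t \<subseteq>\<^sub>m t'" "seg \<kappa> (k n) \<le>o |succs T t'|"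
  shows "succs T t \<noteq> {}"
proof -
  obtain c where c: "c \<in> succs T t'"
    using infinite_if_large[OF regular t(4)] by fastforce
  then have "t \<subseteq>\<^sub>m c" "height t < height c"
    using succsD[OF T c] t(3) height_mono[OF tree_node[OF T t(1)] tree_node[OF T t(2)]]
    by (auto intro: map_le_trans)
  then show ?thesis
    using succ_between[OF T succsD(1)[OF T c] tree_node[OF T t(1)]] by blast
qed

text \<open>Suitability is automatic: a splitting node above \<open>t\<close> forces
  \<open>t\<close> to have a child.\<close>

lemma perfectI:
  assumes T: "is_tree \<kappa> k T" and ne: "T \<noteq> {}"
    and split: "\<And>n t. t \<in> T \<Longrightarrow> \<exists>t'\<in>T. t \<subseteq>\<^sub>m t' \<and> seg \<kappa> (k n) \<le>o |succs T t'|"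
  shows "perfect \<kappa> k T"
  unfolding perfect_def
  using T split suitableI[OF T ne] succs_ne_if_large_above[OF T] by metis

lemma perfect_tree: "perfect \<kappa> k T \<Longrightarrow> is_tree \<kappa> k T"
  by (simp add: perfect_def)

lemma perfect_ne: "perfect \<kappa> k T \<Longrightarrow> T \<noteq> {}"
  by (simp add: perfect_def suitable_def non_stopping_def)

lemma perfect_split:
  "perfect \<kappa> k T \<Longrightarrow> t \<in> T \<Longrightarrow> \<exists>t'\<in>T. t \<subseteq>\<^sub>m t' \<and> seg \<kappa> (k n) \<le>o |succs T t'|"
  by (simp add: perfect_def)

lemma perfect_succs_ne: "perfect \<kappa> k T \<Longrightarrow> t \<in> T \<Longrightarrow> succs T t \<noteq> {}"
  using perfect_split succs_ne_if_large_above perfect_tree by metis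

lemma perfect_tall:
  assumes "perfect \<kappa> k T" "t \<in> T"
  shows "\<exists>u\<in>T. t \<subseteq>\<^sub>m u \<and> n \<le> height u"
proof (induction n)
  case 0
  then show ?case using assms(2) map_le_refl by blast
next
  case (Suc n)
  then obtain u where u: "u \<in> T" "t \<subseteq>\<^sub>m u" "n \<le> height u" by blast
  then obtain c where "c \<in> succs T u"
    using perfect_succs_ne[OF assms(1)] by blast
  with u show ?case
    using succsD[OF perfect_tree[OF assms(1)]] by (metis map_le_trans Suc_le_mono)
qed

text \<open>The usual restriction of a tree to a node. Nodes below \<open>t\<close> are kept for
  closure under initial segments; from \<open>t\<close> upwards the children are those of
  \<open>T\<close>.\<close>

definition cone :: "(nat \<rightharpoonup> 'a) set \<Rightarrow> (nat \<rightharpoonup> 'a) \<Rightarrow> (nat \<rightharpoonup> 'a) set" where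
  "cone T t = {u \<in> T. u \<subseteq>\<^sub>m t \<or> t \<subseteq>\<^sub>m u}"

lemma tree_cone:
  assumes T: "is_tree \<kappa> k T" and t: "t \<in> T"
  shows "is_tree \<kappa> k (cone T t)"
proof -
  have "u |` {..<j} \<in> cone T t" if u: "u \<in> cone T t" for u j
  proof -
    have "u |` {..<j} \<in> T" using u T by (auto simp: cone_def is_tree_def)
    moreover have "u |` {..<j} \<subseteq>\<^sub>m t \<or> t \<subseteq>\<^sub>m u |` {..<j}"
    proof (cases "u \<subseteq>\<^sub>m t")
      case True
      then show ?thesis using map_le_trans restrict_map_le by blast
    next
      case False
      then have "t \<subseteq>\<^sub>m u" using u by (auto simp: cone_def)
      then show ?thesis
        using nodes_comparable[of "u |` {..<j}" t u] nodes_comparable[of t "u |` {..<j}" u]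
          tree_node[OF T] t \<open>u |` {..<j} \<in> T\<close> restrict_map_le nle_le by blast
    qed
    ultimately show ?thesis by (simp add: cone_def)
  qed
  then show ?thesis
    using T by (auto simp: is_tree_def cone_def)
qed

lemma succs_cone:
  assumes "is_tree \<kappa> k T" "t \<subseteq>\<^sub>m u"
  shows "succs (cone T t) u = succs T u"
  using succsD(2)[OF assms(1)] map_le_trans[OF assms(2)] by (auto simp: succs_def cone_def)

lemma perfect_cone:
  assumes T: "perfect \<kappa> k T" and t: "t \<in> T"
  shows "perfect \<kappa> k (cone T t)"
proof (rule perfectI)
  show "is_tree \<kappa> k (cone T t)" using tree_cone[OF perfect_tree[OF T] t] .
  show "cone T t \<noteq> {}" using t by (auto simp: cone_def)
next
  fix n u assume "u \<in> cone T t"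
  then obtain u' where u': "u' \<in> T" "u \<subseteq>\<^sub>m u'" "t \<subseteq>\<^sub>m u'"
    using t by (auto simp: cone_def)
  obtain v where v: "v \<in> T" "u' \<subseteq>\<^sub>m v" "seg \<kappa> (k n) \<le>o |succs T v|"
    using perfect_split[OF T u'(1)] by blast
  then have "t \<subseteq>\<^sub>m v" "u \<subseteq>\<^sub>m v"
    using u' map_le_trans by blast+
  then show "\<exists>v\<in>cone T t. u \<subseteq>\<^sub>m v \<and> seg \<kappa> (k n) \<le>o |succs (cone T t) v|"
    using v succs_cone[OF perfect_tree[OF T]] by (auto simp: cone_def)
qed

text \<open>A perfect tree has arbitrarily tall nodes, and one at least as tall as \<open>t\<close>
  that is comparable with \<open>t\<close> must extend it. Shrinking a cone therefore never loses
  its base node.\<close>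

lemma perfect_sub_cone:
  assumes S: "perfect \<kappa> k S" and sub: "S \<subseteq> cone T t" and t: "t \<in> nodes \<kappa> k"
  shows "t \<in> S"
proof -
  obtain s where "s \<in> S" using perfect_ne[OF S] by blast
  then obtain u where u: "u \<in> S" "height t \<le> height u"
    using perfect_tall[OF S] by blast
  have "u \<in> nodes \<kappa> k" using u tree_node[OF perfect_tree[OF S]] by blast
  then have "t \<subseteq>\<^sub>m u"
    using u sub t nodes_comparable[of t u] height_mono[of u t] unfolding cone_def
    by (metis (mono_tags, lifting) mem_Collect_eq subsetD map_le_refl)
  then show ?thesis using tree_down[OF perfect_tree[OF S] u(1) t] by blast
qed

end

section \<open>Fusion\<close>

text \<open>A position is a pair of a stem and a tree. The set \<open>G n\<close> consists of the good positions at
  stage \<open>n\<close>, and \<open>nxt n p c\<close> is the position chosen above the child \<open>c\<close> of the stem of \<open>p\<close>.\<close>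

locale fusion = tree_forcing \<kappa> k for \<kappa> :: "'a rel" and k +
  fixes p0 :: "(nat \<rightharpoonup> 'a) \<times> (nat \<rightharpoonup> 'a) set"
    and G :: "nat \<Rightarrow> ((nat \<rightharpoonup> 'a) \<times> (nat \<rightharpoonup> 'a) set) set"
    and C :: "nat \<Rightarrow> (nat \<rightharpoonup> 'a) \<times> (nat \<rightharpoonup> 'a) set \<Rightarrow> (nat \<rightharpoonup> 'a) set"
    and nxt :: "nat \<Rightarrow> (nat \<rightharpoonup> 'a) \<times> (nat \<rightharpoonup> 'a) set \<Rightarrow> (nat \<rightharpoonup> 'a) \<Rightarrow>
      (nat \<rightharpoonup> 'a) \<times> (nat \<rightharpoonup> 'a) set"
  assumes p0: "p0 \<in> G 0"
    and G: "p \<in> G n \<Longrightarrow> is_tree \<kappa> k (snd p)" "p \<in> G n \<Longrightarrow> fst p \<in> snd p"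
      "p \<in> G n \<Longrightarrow> u \<in> snd p \<Longrightarrow> u \<subseteq>\<^sub>m fst p \<or> fst p \<subseteq>\<^sub>m u"
    and C: "p \<in> G n \<Longrightarrow> C n p \<subseteq> succs (snd p) (fst p)"
      "p \<in> G n \<Longrightarrow> seg \<kappa> (k n) \<le>o |C n p|"
    and nxt: "p \<in> G n \<Longrightarrow> c \<in> C n p \<Longrightarrow> nxt n p c \<in> G (Suc n)"
      "p \<in> G n \<Longrightarrow> c \<in> C n p \<Longrightarrow> snd (nxt n p c) \<subseteq> snd p"
      "p \<in> G n \<Longrightarrow> c \<in> C n p \<Longrightarrow> c \<subseteq>\<^sub>m fst (nxt n p c)"
begin

text \<open>The positions reached after \<open>n\<close> rounds from \<open>p0\<close> when every
  child in \<open>C\<close> is followed.\<close>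

primrec level :: "nat \<Rightarrow> ((nat \<rightharpoonup> 'a) \<times> (nat \<rightharpoonup> 'a) set) set" where
  "level 0 = {p0}"
| "level (Suc n) = {nxt n p c | p c. p \<in> level n \<and> c \<in> C n p}"

text \<open>The fusion is generated by the stems, so that every node lies below a stem, where the
  splitting is known.\<close>

definition fused :: "(nat \<rightharpoonup> 'a) set" where
  "fused = {u \<in> nodes \<kappa> k. \<exists>n. \<exists>p\<in>level n. u \<subseteq>\<^sub>m fst p}"

lemma level_G: "p \<in> level n \<Longrightarrow> p \<in> G n"
  by (induction n arbitrary: p) (auto simp: p0 nxt)

lemma level_node: "p \<in> level n \<Longrightarrow> fst p \<in> nodes \<kappa> k"
  using level_G G(1,2) tree_node by blast

lemma C_D:
  assumes "p \<in> level n" "c \<in> C n p"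
  shows "c \<in> nodes \<kappa> k" "fst p \<subseteq>\<^sub>m c" "height c = Suc (height (fst p))" "c \<in> snd p"
    "fst p \<subseteq>\<^sub>m fst (nxt n p c)"
proof -
  have p: "p \<in> G n" using assms level_G by blast
  then have c: "c \<in> succs (snd p) (fst p)" using C(1) assms by blast
  show "c \<in> nodes \<kappa> k" "fst p \<subseteq>\<^sub>m c" "height c = Suc (height (fst p))" "c \<in> snd p"
    using succsD[OF G(1)[OF p] c] tree_node[OF G(1)[OF p]] by auto
  then show "fst p \<subseteq>\<^sub>m fst (nxt n p c)"
    using nxt(3)[OF p assms(2)] map_le_trans by blast
qed

lemma level_SucI: "p \<in> level n \<Longrightarrow> c \<in> C n p \<Longrightarrow> nxt n p c \<in> level (Suc n)"
  by (simp only: level.simps) blast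

lemma C_ne: "p \<in> level n \<Longrightarrow> C n p \<noteq> {}"
  using infinite_if_large[OF regular C(2)[OF level_G]] by fastforce

lemma ancestor:
  assumes "m \<le> n" "p \<in> level n"
  shows "\<exists>p'\<in>level m. fst p' \<subseteq>\<^sub>m fst p \<and> snd p \<subseteq> snd p'"
  using assms
proof (induction n arbitrary: p rule: dec_induct)
  case base
  then show ?case using map_le_refl by blast
next
  case (step n)
  then obtain p1 c where p1: "p1 \<in> level n" "c \<in> C n p1" "p = nxt n p1 c" by auto
  then have "fst p1 \<subseteq>\<^sub>m fst p" "snd p \<subseteq> snd p1"
    using C_D(5) nxt(2) level_G by blast+
  with step.IH[OF p1(1)] show ?case by (meson map_le_trans order_trans)
qed

lemma descendant:
  assumes "p \<in> level n"
  shows "\<exists>p'\<in>level (n + m). fst p \<subseteq>\<^sub>m fst p'"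
proof (induction m)
  case 0
  then show ?case using assms by (metis add.right_neutral map_le_refl)
next
  case (Suc m)
  then obtain p' where p': "p' \<in> level (n + m)" "fst p \<subseteq>\<^sub>m fst p'" by blast
  obtain c where c: "c \<in> C (n + m) p'" using C_ne[OF p'(1)] by blast
  have "nxt (n + m) p' c \<in> level (n + Suc m)" using level_SucI[OF p'(1) c] by simp
  then show ?case using C_D(5)[OF p'(1) c] p'(2) map_le_trans by blast
qed

text \<open>By induction the two positions have the same predecessor. The children chosen above its
  stem have equal height and both lie below \<open>f\<close>, so they coincide too.\<close>

lemma level_unique:
  assumes "p \<in> level n" "p' \<in> level n" "fst p \<subseteq>\<^sub>m f" "fst p' \<subseteq>\<^sub>m f"
  shows "p = p'"
  using assms
proof (induction n arbitrary: p p')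
  case 0
  then show ?case by simp
next
  case (Suc n)
  obtain q c where q: "q \<in> level n" "c \<in> C n q" "p = nxt n q c" using Suc.prems(1) by auto
  obtain q' c' where q': "q' \<in> level n" "c' \<in> C n q'" "p' = nxt n q' c'" using Suc.prems(2) by auto
  have c: "c \<subseteq>\<^sub>m f" "c' \<subseteq>\<^sub>m f"
    using q q' nxt(3) level_G Suc.prems map_le_trans by metis+
  then have "q = q'"
    using Suc.IH[OF q(1) q'(1)] C_D(2) q q' map_le_trans by metis
  moreover have "c = c'"
    using nodes_eq[of c c' f] C_D(1,3) q q' c \<open>q = q'\<close> by metis
  ultimately show ?case using q q' by simp
qed

text \<open>No \<open>C n p\<close> is empty, so every position has descendants on all later levels
  and the witnessing stem can be taken as late as desired.\<close>

lemma fusedE: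
  assumes "u \<in> fused"
  obtains n p where "m \<le> n" "p \<in> level n" "u \<subseteq>\<^sub>m fst p"
proof -
  obtain n p where p: "p \<in> level n" "u \<subseteq>\<^sub>m fst p" using assms by (auto simp: fused_def)
  then obtain p' where "p' \<in> level (n + m)" "fst p \<subseteq>\<^sub>m fst p'" using descendant by blast
  then show thesis using that[of "n + m" p'] p map_le_trans by auto
qed

lemma fused_node: "u \<in> fused \<Longrightarrow> u \<in> nodes \<kappa> k"
  by (simp add: fused_def)

lemma fst_level_fused: "p \<in> level n \<Longrightarrow> fst p \<in> fused"
  using level_node map_le_refl unfolding fused_def by blast

lemma tree_fused: "is_tree \<kappa> k fused"
  unfolding is_tree_def
proof (intro conjI ballI allI)
  show "fused \<subseteq> nodes \<kappa> k" using fused_node by blast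
  show "u |` {..<j} \<in> fused" if "u \<in> fused" for u j
    using that node_restrict restrict_map_le map_le_trans unfolding fused_def by blast
qed

lemma C_sub_succs_fused:
  assumes "p \<in> level n"
  shows "C n p \<subseteq> succs fused (fst p)"
proof
  fix c assume c: "c \<in> C n p"
  have "nxt n p c \<in> level (Suc n)" using assms c by (rule level_SucI)
  then have "c \<in> fused"
    using nxt(3)[OF level_G[OF assms] c] C_D(1)[OF assms c] unfolding fused_def by blast
  then show "c \<in> succs fused (fst p)"
    using C(1)[OF level_G[OF assms]] c by (auto simp: succs_def)
qed

text \<open>A node lies below a stem of some level \<open>n\<close> with \<open>m \<le> n\<close>,
  and that stem keeps all of \<open>C n p\<close> as children, at least
  \<open>seg \<kappa> (k m)\<close> many.\<close>

lemma perfect_fused: "perfect \<kappa> k fused"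
proof (rule perfectI)
  show "is_tree \<kappa> k fused" by (rule tree_fused)
  show "fused \<noteq> {}" using fst_level_fused[of p0 0] by auto
next
  fix m u assume "u \<in> fused"
  then obtain n p where p: "m \<le> n" "p \<in> level n" "u \<subseteq>\<^sub>m fst p" by (rule fusedE)
  have "seg \<kappa> (k m) \<le>o |C n p|"
    using mono[OF p(1)] C(2)[OF level_G[OF p(2)]] ordLeq_transitive by blast
  then have "seg \<kappa> (k m) \<le>o |succs fused (fst p)|"
    using card_of_mono1[OF C_sub_succs_fused[OF p(2)]] ordLeq_transitive by blast
  then show "\<exists>t'\<in>fused. u \<subseteq>\<^sub>m t' \<and> seg \<kappa> (k m) \<le>o |succs fused t'|"
    using p fst_level_fused by blast
qed

lemma fused_sub: "fused \<subseteq> snd p0"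
proof
  fix u assume u: "u \<in> fused"
  then obtain n p where p: "p \<in> level n" "u \<subseteq>\<^sub>m fst p" by (auto simp: fused_def)
  then have "fst p \<in> snd p0"
    using ancestor[of 0 n p] G(2)[OF level_G[OF p(1)]] by auto
  then show "u \<in> snd p0"
    using tree_down[OF G(1)[OF p0]] fused_node[OF u] p(2) by blast
qed

text \<open>A node above the stem of \<open>p\<close> lies below a later stem. By uniqueness on
  levels that later position descends from \<open>p\<close>, so its tree is contained in
  \<open>snd p\<close>.\<close>

lemma fused_cone_sub:
  assumes p: "p \<in> level n" and u: "u \<in> fused" "u \<subseteq>\<^sub>m fst p \<or> fst p \<subseteq>\<^sub>m u"
  shows "u \<in> snd p"
proof (cases "u \<subseteq>\<^sub>m fst p")
  case True
  then show ?thesis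
    using tree_down[OF G(1,2)[OF level_G[OF p]]] fused_node[OF u(1)] by blast
next
  case False
  then have pu: "fst p \<subseteq>\<^sub>m u" using u by blast
  obtain n' p' where p': "n \<le> n'" "p' \<in> level n'" "u \<subseteq>\<^sub>m fst p'" using u(1) by (rule fusedE)
  obtain q where q: "q \<in> level n" "fst q \<subseteq>\<^sub>m fst p'" "snd p' \<subseteq> snd q"
    using ancestor[OF p'(1,2)] by blast
  have "q = p" using level_unique[OF q(1) p q(2)] pu p'(3) map_le_trans by blast
  then show ?thesis
    using tree_down[OF G(1)[OF level_G[OF p]] _ fused_node[OF u(1)] p'(3)]
      G(2)[OF level_G[OF p'(2)]] q(3) by blast
qed

text \<open>A sufficiently late stem above \<open>u\<close> has an ancestor on level
  \<open>Suc n\<close>. Uniqueness identifies its predecessor with \<open>p\<close> and its chosen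
  child with \<open>c\<close>.\<close>

lemma fused_above_succ:
  assumes p: "p \<in> level n" and c: "c \<in> nodes \<kappa> k" "fst p \<subseteq>\<^sub>m c" "height c = Suc (height (fst p))"
    and u: "u \<in> fused" "c \<subseteq>\<^sub>m u"
  shows "c \<in> C n p \<and> (u \<subseteq>\<^sub>m fst (nxt n p c) \<or> fst (nxt n p c) \<subseteq>\<^sub>m u)"
proof -
  obtain n' p' where p': "Suc n \<le> n'" "p' \<in> level n'" "u \<subseteq>\<^sub>m fst p'" using u(1) by (rule fusedE)
  obtain q where q: "q \<in> level (Suc n)" "fst q \<subseteq>\<^sub>m fst p'"
    using ancestor[OF p'(1,2)] by blast
  then obtain p1 c1 where p1: "p1 \<in> level n" "c1 \<in> C n p1" "q = nxt n p1 c1" by auto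
  have c1: "c1 \<subseteq>\<^sub>m fst p'" using nxt(3)[OF level_G[OF p1(1)] p1(2)] p1(3) q(2) map_le_trans by blast
  have cp: "c \<subseteq>\<^sub>m fst p'" using u(2) p'(3) map_le_trans by blast
  have "p1 = p"
    using level_unique[OF p1(1) p] C_D(2)[OF p1(1,2)] c1 cp c(2) map_le_trans by blast
  moreover have "c1 = c"
    using nodes_eq[OF C_D(1)[OF p1(1,2)] c(1) c1 cp] C_D(3)[OF p1(1,2)] c(3) \<open>p1 = p\<close> by simp
  moreover have "u \<subseteq>\<^sub>m fst q \<or> fst q \<subseteq>\<^sub>m u"
    using nodes_comparable[of u "fst q" "fst p'"] nodes_comparable[of "fst q" u "fst p'"]
      level_node[OF q(1)] fused_node[OF u(1)] q(2) p'(3) nle_le by blast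
  ultimately show ?thesis using p1 by simp
qed

text \<open>A perfect subtree cannot slip between the stems: past one stem it must use a chosen
  child, and a tall enough node above that child extends the next stem.\<close>

lemma meets_level:
  assumes r: "perfect \<kappa> k r" and sub: "r \<subseteq> fused"
  shows "\<exists>p\<in>level n. fst p \<in> r"
proof (induction n)
  case 0
  obtain u0 where "u0 \<in> r" using perfect_ne[OF r] by blast
  then obtain u where u: "u \<in> r" "height (fst p0) \<le> height u" using perfect_tall[OF r] by blast
  obtain n p where p: "p \<in> level n" "u \<subseteq>\<^sub>m fst p" using u sub by (auto simp: fused_def)
  have "fst p0 \<subseteq>\<^sub>m fst p" using ancestor[of 0 n p] p by auto
  then have "fst p0 \<subseteq>\<^sub>m u"
    using nodes_comparable[OF level_node[of p0 0] fused_node] u sub p by (metis level.simps(1) singletonI subsetD)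
  then show ?case
    using tree_down[OF perfect_tree[OF r] u(1)] level_node[of p0 0] by auto
next
  case (Suc n)
  then obtain p where p: "p \<in> level n" "fst p \<in> r" by blast
  note T = perfect_tree[OF r]
  obtain c where "c \<in> succs r (fst p)" using perfect_succs_ne[OF r p(2)] by blast
  note c = succsD[OF T this]
  note succ = fused_above_succ[OF p(1) tree_node[OF T c(1)] c(2,3)]
  let ?q = "nxt n p c"
  obtain u where u: "u \<in> r" "c \<subseteq>\<^sub>m u" "height (fst ?q) \<le> height u"
    using perfect_tall[OF r c(1)] by blast
  have cC: "c \<in> C n p" and cmp: "u \<subseteq>\<^sub>m fst ?q \<or> fst ?q \<subseteq>\<^sub>m u"
    using succ[of u] u sub by auto
  have q: "?q \<in> level (Suc n)" using p(1) cC by (rule level_SucI)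
  have "fst ?q \<subseteq>\<^sub>m u"
    using cmp nodes_comparable[OF level_node[OF q] tree_node[OF T u(1)] map_le_refl _ u(3)]
      nodes_comparable[OF level_node[OF q] tree_node[OF T u(1)]] u(3) by blast
  then have "fst ?q \<in> r" using tree_down[OF T u(1) level_node[OF q]] by blast
  with q show ?case by blast
qed

text \<open>This carries decisions from positions to the fusion: the cone of \<open>r\<close> at a
  stem of level \<open>n\<close> lies in the tree attached to that stem.\<close>

lemma below_level:
  assumes r: "perfect \<kappa> k r" and sub: "r \<subseteq> fused"
  shows "\<exists>p\<in>level n. \<exists>r'. perfect \<kappa> k r' \<and> r' \<subseteq> r \<and> r' \<subseteq> snd p"
proof -
  obtain p where p: "p \<in> level n" "fst p \<in> r" using meets_level[OF r sub] by blast
  have "cone r (fst p) \<subseteq> snd p"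
    using fused_cone_sub[OF p(1)] sub by (auto simp: cone_def)
  then show ?thesis using p perfect_cone[OF r p(2)] by (auto simp: cone_def)
qed

end

section \<open>From the game to a perfect tree deciding a whole sequence\<close>

context tree_forcing
begin

text \<open>Read \<open>D n v S\<close> as: \<open>S\<close> decides the \<open>n\<close>-th value
  to be \<open>v\<close>. Keeping \<open>D\<close> abstract covers antichains of trees, partitions
  in the completion and names of functions alike. The second player's good positions for one
  \<open>h\<close> are fused.\<close>

lemma decide_sequence:
  fixes A :: "nat \<Rightarrow> 'v set"
  assumes small: "|{h. \<forall>n. h n \<in> A n}| <o seg \<kappa> (k e)"
    and T: "perfect \<kappa> k T"
    and dense: "\<And>n S. perfect \<kappa> k S \<Longrightarrow> S \<subseteq> T \<Longrightarrow> \<exists>v\<in>A n. \<exists>S'\<subseteq>S. perfect \<kappa> k S' \<and> D n v S'"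
    and down: "\<And>n v S S'. D n v S \<Longrightarrow> perfect \<kappa> k S' \<Longrightarrow> S' \<subseteq> S \<Longrightarrow> D n v S'"
  obtains q h where "perfect \<kappa> k q" "q \<subseteq> T" "\<And>n. h n \<in> A n"
    "\<And>n r. perfect \<kappa> k r \<Longrightarrow> r \<subseteq> q \<Longrightarrow> \<exists>r'\<subseteq>r. perfect \<kappa> k r' \<and> D n (h n) r'"
proof -
  \<comment> \<open>Shifting by \<open>e\<close> makes the required number of children exceed the
    number of candidate sequences at every stage.\<close>
  define Pos where "Pos n = {(t, S). perfect \<kappa> k S \<and> S \<subseteq> T \<and> t \<in> S \<and>
      (\<forall>u\<in>S. u \<subseteq>\<^sub>m t \<or> t \<subseteq>\<^sub>m u) \<and> seg \<kappa> (k (e + n)) \<le>o |succs S t|}" for n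
  define ch where "ch p = succs (snd p) (fst p)" for p :: "(nat \<rightharpoonup> 'a) \<times> (nat \<rightharpoonup> 'a) set"
  define step where "step n v p c p' \<longleftrightarrow> snd p' \<subseteq> snd p \<and> c \<subseteq>\<^sub>m fst p' \<and> D n v (snd p')"
    for n v c and p p' :: "(nat \<rightharpoonup> 'a) \<times> (nat \<rightharpoonup> 'a) set"
  have cone_Pos: "(t, cone S t) \<in> Pos n"
    if "perfect \<kappa> k S" "S \<subseteq> T" "t \<in> S" "seg \<kappa> (k (e + n)) \<le>o |succs S t|" for t S n
    using that perfect_cone[of S t] succs_cone[OF perfect_tree, of S t t] map_le_refl[of t]
    by (auto simp: Pos_def cone_def)
  have card: "|{h. \<forall>n. h n \<in> A n}| <o seg \<kappa> (k (e + n))" for n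
    using small mono[of e "e + n"] ordLess_ordLeq_trans by fastforce
  have large: "seg \<kappa> (k (e + n)) \<le>o |ch p|" if "p \<in> Pos n" for n p
    using that by (auto simp: Pos_def ch_def)
  have move: "\<exists>v\<in>A n. \<exists>p'\<in>Pos (Suc n). step n v p c p'" if p: "p \<in> Pos n" and c: "c \<in> ch p" for n p c
  proof -
    have S: "perfect \<kappa> k (snd p)" "snd p \<subseteq> T"
      using p by (auto simp: Pos_def)
    have cS: "c \<in> snd p"
      using c succsD(1)[OF perfect_tree[OF S(1)]] by (auto simp: ch_def)
    have "cone (snd p) c \<subseteq> T" using S(2) by (auto simp: cone_def)
    then obtain v S' where S': "v \<in> A n" "S' \<subseteq> cone (snd p) c" "perfect \<kappa> k S'" "D n v S'"
      using dense[OF perfect_cone[OF S(1) cS]] by blast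
    \<comment> \<open>The child \<open>c\<close> survives the shrinking, so the next stem can be a
      node above it with enough children for stage \<open>Suc n\<close>.\<close>
    have "c \<in> S'"
      using perfect_sub_cone[OF S'(3,2)] tree_node[OF perfect_tree[OF S(1)] cS] by blast
    then obtain t' where t': "t' \<in> S'" "c \<subseteq>\<^sub>m t'" "seg \<kappa> (k (e + Suc n)) \<le>o |succs S' t'|"
      using perfect_split[OF S'(3)] by blast
    have sub: "S' \<subseteq> snd p" using S'(2) by (auto simp: cone_def)
    have "step n v p c (t', cone S' t')"
      using sub t' down[OF S'(4) perfect_cone[OF S'(3) t'(1)]] by (auto simp: step_def cone_def)
    moreover have "(t', cone S' t') \<in> Pos (Suc n)"
      using cone_Pos[OF S'(3) _ t'(1,3)] sub S(2) by blast
    ultimately show ?thesis using S'(1) by blast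
  qed
  obtain t0 where t0: "(t0, cone T t0) \<in> Pos 0"
    using perfect_ne[OF T] perfect_split[OF T] cone_Pos[OF T, of _ 0] by fastforce
  obtain h G where h: "\<And>n. h n \<in> A n" and G: "(t0, cone T t0) \<in> G 0" "\<And>n. G n \<subseteq> Pos n"
      "\<And>n p. p \<in> G n \<Longrightarrow> seg \<kappa> (k (e + n)) \<le>o |{c \<in> ch p. \<exists>p'\<in>G (Suc n). step n (h n) p c p'}|"
  proof (rule second_player_strategy[where r = "\<lambda>n. seg \<kappa> (k (e + n))" and A = A and Pos = Pos and ch = ch
        and step = step, OF regular card large move t0])
    fix h G assume "\<And>n. h n \<in> A n" "(t0, cone T t0) \<in> G 0" "\<And>n. G n \<subseteq> Pos n"
      "\<And>n p. p \<in> G n \<Longrightarrow> seg \<kappa> (k (e + n)) \<le>o |{c \<in> ch p. \<exists>p'\<in>G (Suc n). step n (h n) p c p'}|"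
    then show thesis by (rule that)
  qed
  define C where "C n p = {c \<in> ch p. \<exists>p'\<in>G (Suc n). step n (h n) p c p'}" for n p
  define nxt where "nxt n p c = (SOME p'. p' \<in> G (Suc n) \<and> step n (h n) p c p')" for n p c
  have nxt_step: "nxt n p c \<in> G (Suc n) \<and> step n (h n) p c (nxt n p c)" if "c \<in> C n p" for n p c
    unfolding nxt_def using that by (intro someI_ex[of "\<lambda>p'. p' \<in> G (Suc n) \<and> step n (h n) p c p'"]) (auto simp: C_def)
  interpret fusion \<kappa> k "(t0, cone T t0)" G C nxt
  proof
    show "(t0, cone T t0) \<in> G 0" by fact
    fix p n assume p: "p \<in> G n"
    then have pos: "p \<in> Pos n" using G(2) by blast
    then show "is_tree \<kappa> k (snd p)" "fst p \<in> snd p"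
      by (auto simp: Pos_def perfect_tree)
    show "u \<subseteq>\<^sub>m fst p \<or> fst p \<subseteq>\<^sub>m u" if "u \<in> snd p" for u
      using pos that by (auto simp: Pos_def)
    show "C n p \<subseteq> succs (snd p) (fst p)" by (auto simp: C_def ch_def)
    \<comment> \<open>The game supplies the bound with index \<open>e + n\<close>, which dominates
      the one that fusion asks for.\<close>
    show "seg \<kappa> (k n) \<le>o |C n p|"
      using G(3)[OF p] mono[of n "e + n"] ordLeq_transitive unfolding C_def by fastforce
    fix c assume "c \<in> C n p"
    then show "nxt n p c \<in> G (Suc n)" "snd (nxt n p c) \<subseteq> snd p" "c \<subseteq>\<^sub>m fst (nxt n p c)"
      using nxt_step[of c n p] by (auto simp: step_def)
  qed
  \<comment> \<open>The \<open>n\<close>-th value is decided by the move from level \<open>n\<close>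
    to level \<open>Suc n\<close>; hence the shift of index.\<close>
  have D: "D n (h n) (snd p)" if p: "p \<in> level (Suc n)" for n p
  proof -
    obtain p1 c where "c \<in> C n p1" "p = nxt n p1 c" using p unfolding level.simps by blast
    then show ?thesis using nxt_step[of c n p1] by (simp add: step_def)
  qed
  show thesis
  proof
    show "perfect \<kappa> k fused" by (rule perfect_fused)
    show "fused \<subseteq> T" using fused_sub by (auto simp: cone_def)
    show "h n \<in> A n" for n by (rule h)
    show "\<exists>r'\<subseteq>r. perfect \<kappa> k r' \<and> D n (h n) r'" if "perfect \<kappa> k r" "r \<subseteq> fused" for n r
      using below_level[OF that, of "Suc n"] D down by blast
  qed
qed

end

section \<open>Antichains and regular open sets\<close>

text \<open>Take an antichain maximal among those inside \<open>E\<close>. If some \<open>x\<close>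
  of \<open>Q\<close> could still be added, so could an element of \<open>E\<close> below
  \<open>x\<close>, contradicting the choice.\<close>

lemma dense_maximal_antichain:
  assumes E: "E \<subseteq> Q" and dense: "\<And>p. p \<in> Q \<Longrightarrow> \<exists>e\<in>E. e \<subseteq> p"
  obtains R where "maximal_antichain Q R" "R \<subseteq> E"
proof -
  let ?X = "{R. antichain Q R \<and> R \<subseteq> E}"
  have "\<exists>R\<in>?X. \<forall>R'\<in>?X. R \<subseteq> R' \<longrightarrow> R' = R"
  proof (rule subset_Zorn')
    fix \<C> assume ch: "subset.chain ?X \<C>"
    have mem: "antichain Q X" "X \<subseteq> E" if "X \<in> \<C>" for X
      using ch that unfolding subset.chain_def by blast+
    have "\<not> compatible Q p q" if pq: "p \<in> \<Union>\<C>" "q \<in> \<Union>\<C>" "p \<noteq> q" for p q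
    proof -
      obtain X Y where XY: "X \<in> \<C>" "p \<in> X" "Y \<in> \<C>" "q \<in> Y" using pq by blast
      then have "X \<subseteq> Y \<or> Y \<subseteq> X" using ch unfolding subset.chain_def by blast
      then obtain Z where "Z \<in> \<C>" "p \<in> Z" "q \<in> Z" using XY by blast
      then show ?thesis using mem(1) pq(3) unfolding antichain_def by blast
    qed
    moreover have "\<Union>\<C> \<subseteq> E" using mem(2) by blast
    ultimately show "\<Union>\<C> \<in> ?X"
      using E unfolding antichain_def mem_Collect_eq by (meson subset_trans)
  qed
  then obtain R where R: "antichain Q R" "R \<subseteq> E"
    and max: "\<And>R'. antichain Q R' \<Longrightarrow> R' \<subseteq> E \<Longrightarrow> R \<subseteq> R' \<Longrightarrow> R' = R"
    by (metis (no_types, lifting) mem_Collect_eq)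
  have "A = R" if A: "antichain Q A" "R \<subseteq> A" for A
  proof (rule ccontr)
    assume "A \<noteq> R"
    then obtain x where x: "x \<in> A" "x \<notin> R" using A by blast
    have AQ: "A \<subseteq> Q" and incomp: "\<And>p q. p \<in> A \<Longrightarrow> q \<in> A \<Longrightarrow> p \<noteq> q \<Longrightarrow> \<not> compatible Q p q"
      using A(1) unfolding antichain_def by blast+
    obtain e where e: "e \<in> E" "e \<subseteq> x" using dense[of x] AQ x(1) by blast
    have incompatible: "\<not> compatible Q e r" "\<not> compatible Q r e" if "r \<in> R" for r
    proof -
      have "\<not> compatible Q x r" "\<not> compatible Q r x"
        using incomp[of x r] incomp[of r x] x that A(2) by blast+
      then show "\<not> compatible Q e r" "\<not> compatible Q r e"
        using e(2) unfolding compatible_def by (meson order_trans)+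
    qed
    have "antichain Q (insert e R)"
      using R(1) e(1) E incompatible unfolding antichain_def by auto
    then have "e \<in> R" using max[of "insert e R"] e(1) R(2) by blast
    then have "\<not> compatible Q e e" using incompatible by blast
    then show False using e(1) E unfolding compatible_def by blast
  qed
  then show thesis using that[of R] R unfolding maximal_antichain_def by blast
qed

lemma maximal_antichain_sub: "maximal_antichain Q W \<Longrightarrow> W \<subseteq> Q"
  by (simp add: maximal_antichain_def antichain_def)

lemma compatible_sym: "compatible Q p q \<Longrightarrow> compatible Q q p"
  by (auto simp: compatible_def)

lemma maximal_antichain_meets:
  assumes W: "maximal_antichain Q W" and p: "p \<in> Q"
  obtains w r where "w \<in> W" "r \<in> Q" "r \<subseteq> p" "r \<subseteq> w"
proof -
  have "\<exists>w\<in>W. compatible Q p w"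
  proof (rule ccontr)
    assume neg: "\<not> ?thesis"
    then have "\<not> compatible Q p w" "\<not> compatible Q w p" if "w \<in> W" for w
      using that compatible_sym by blast+
    then have "antichain Q (insert p W)"
      using W p by (auto simp: maximal_antichain_def antichain_def)
    then have "insert p W = W"
      using W unfolding maximal_antichain_def by (meson subset_insertI)
    then have "\<not> compatible Q p p" using neg by blast
    then show False using p by (auto simp: compatible_def)
  qed
  then show thesis using that by (auto simp: compatible_def)
qed

text \<open>The assumption says that conditions lying below a member of each \<open>W l\<close> are
  dense; a maximal antichain of such conditions refines all the \<open>W l\<close>.\<close>

lemma distributive_lawI:
  assumes "\<And>W p. (\<And>l. l \<in> L \<Longrightarrow> maximal_antichain Q (W l) \<and> |W l| \<le>o \<mu>) \<Longrightarrow> p \<in> Q \<Longrightarrow>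
    \<exists>q\<in>Q. q \<subseteq> p \<and> (\<forall>l\<in>L. \<exists>w\<in>W l. q \<subseteq> w)"
  shows "distributive_law L \<mu> Q"
  unfolding distributive_law_def
proof (intro allI impI)
  fix W assume W: "\<forall>l\<in>L. maximal_antichain Q (W l) \<and> |W l| \<le>o \<mu>"
  let ?E = "{q \<in> Q. \<forall>l\<in>L. \<exists>w\<in>W l. q \<subseteq> w}"
  obtain R where "maximal_antichain Q R" "R \<subseteq> ?E"
  proof (rule dense_maximal_antichain)
    show "?E \<subseteq> Q" by blast
    show "\<exists>e\<in>?E. e \<subseteq> p" if "p \<in> Q" for p
      using assms[of W p] W that by auto
  qed
  then show "\<exists>R. maximal_antichain Q R \<and> (\<forall>l\<in>L. refines R (W l))"
    unfolding refines_def by blast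
qed

section \<open>Regular open sets described by density\<close>

definition regular_hull :: "'b set set \<Rightarrow> 'b set set \<Rightarrow> 'b set set" where
  "regular_hull P V = {p \<in> P. \<forall>q\<in>P. q \<subseteq> p \<longrightarrow> (\<exists>r\<in>V \<inter> P. r \<subseteq> q)}"

text \<open>The conditions below \<open>p\<close> form the least open set containing
  \<open>p\<close>, so it is the only neighbourhood to test.\<close>

lemma closure_of_down_topology:
  "down_topology P closure_of V = {p \<in> P. \<exists>r\<in>V \<inter> P. r \<subseteq> p}"
proof -
  have top: "topspace (down_topology P) = P"
    unfolding topspace_def openin_down_topology by blast
  have cone: "openin (down_topology P) {r \<in> P. r \<subseteq> p}" for p
    unfolding openin_down_topology by blast
  have "(\<forall>T. p \<in> T \<and> openin (down_topology P) T \<longrightarrow> (\<exists>y\<in>V. y \<in> T)) \<longleftrightarrow> (\<exists>r\<in>V \<inter> P. r \<subseteq> p)"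
    if p: "p \<in> P" for p
  proof
    assume "\<forall>T. p \<in> T \<and> openin (down_topology P) T \<longrightarrow> (\<exists>y\<in>V. y \<in> T)"
    from spec[OF this, of "{r \<in> P. r \<subseteq> p}"] have "\<exists>y\<in>V. y \<in> {r \<in> P. r \<subseteq> p}"
      using cone[of p] p by simp
    then show "\<exists>r\<in>V \<inter> P. r \<subseteq> p" by blast
  next
    assume "\<exists>r\<in>V \<inter> P. r \<subseteq> p"
    then show "\<forall>T. p \<in> T \<and> openin (down_topology P) T \<longrightarrow> (\<exists>y\<in>V. y \<in> T)"
      unfolding openin_down_topology by blast
  qed
  then show ?thesis
    unfolding closure_of_def top by (auto simp del: Int_iff)
qed

lemma interior_of_down_topology:
  "down_topology P interior_of V = {p \<in> P. \<forall>q\<in>P. q \<subseteq> p \<longrightarrow> q \<in> V}"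
proof (intro set_eqI iffI)
  fix p assume "p \<in> down_topology P interior_of V"
  then obtain T where "openin (down_topology P) T" "p \<in> T" "T \<subseteq> V"
    unfolding interior_of_def by blast
  then show "p \<in> {p \<in> P. \<forall>q\<in>P. q \<subseteq> p \<longrightarrow> q \<in> V}"
    unfolding openin_down_topology by blast
next
  fix p assume p: "p \<in> {p \<in> P. \<forall>q\<in>P. q \<subseteq> p \<longrightarrow> q \<in> V}"
  then have "p \<in> {q \<in> P. q \<subseteq> p}" "{q \<in> P. q \<subseteq> p} \<subseteq> V" by blast+
  moreover have "openin (down_topology P) {q \<in> P. q \<subseteq> p}"
    unfolding openin_down_topology by blast
  ultimately show "p \<in> down_topology P interior_of V"
    unfolding interior_of_def by blast
qed

lemma interior_closure_down_topology:
  "down_topology P interior_of (down_topology P closure_of V) = regular_hull P V"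
  unfolding closure_of_down_topology interior_of_down_topology regular_hull_def by blast

lemma regular_open_iff: "U \<in> regular_open_algebra P \<longleftrightarrow> regular_hull P U = U"
  by (simp add: regular_open_algebra_def interior_closure_down_topology)

lemma regular_open_down:
  assumes U: "U \<in> regular_open_algebra P" and "p \<in> U" "q \<in> P" "q \<subseteq> p"
  shows "q \<in> U"
proof -
  have "p \<in> regular_hull P U" using assms by (simp add: regular_open_iff)
  then have "q \<in> regular_hull P U"
    using assms(3,4) unfolding regular_hull_def by (auto dest: subset_trans)
  then show ?thesis using U by (simp add: regular_open_iff)
qed

lemma regular_open_sub: "U \<in> regular_open_algebra P \<Longrightarrow> U \<subseteq> P"
  unfolding regular_open_iff by (auto simp: regular_hull_def)

lemma regular_open_dense:
  assumes "U \<in> regular_open_algebra P" "p \<in> P"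
    and "\<And>q. q \<in> P \<Longrightarrow> q \<subseteq> p \<Longrightarrow> \<exists>r\<subseteq>q. r \<in> U"
  shows "p \<in> U"
proof -
  have "p \<in> regular_hull P U"
    using assms(2,3) regular_open_sub[OF assms(1)] unfolding regular_hull_def by blast
  then show ?thesis using assms(1) by (simp add: regular_open_iff)
qed

text \<open>The image of a condition under the canonical map into the regular open
  completion.\<close>

definition generated :: "'b set set \<Rightarrow> 'b set \<Rightarrow> 'b set set" where
  "generated P p = regular_hull P {q \<in> P. q \<subseteq> p}"

lemma generated_iff:
  "x \<in> generated P p \<longleftrightarrow> x \<in> P \<and> (\<forall>q\<in>P. q \<subseteq> x \<longrightarrow> (\<exists>r\<in>P. r \<subseteq> p \<and> r \<subseteq> q))"
proof -
  have "{q \<in> P. q \<subseteq> p} \<inter> P = {q \<in> P. q \<subseteq> p}" by blast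
  then show ?thesis by (simp add: generated_def regular_hull_def Bex_def conj_assoc)
qed

lemma generated_regular_open: "generated P p \<in> regular_open_algebra P"
  unfolding regular_open_iff
proof (intro set_eqI iffI)
  fix x assume x: "x \<in> regular_hull P (generated P p)"
  show "x \<in> generated P p"
    unfolding generated_iff
  proof (intro conjI ballI impI)
    show "x \<in> P" using x by (simp add: regular_hull_def)
    fix q assume "q \<in> P" "q \<subseteq> x"
    then obtain r where r: "r \<in> P" "r \<in> generated P p" "r \<subseteq> q"
      using x by (auto simp: regular_hull_def)
    then obtain s where "s \<in> P" "s \<subseteq> p" "s \<subseteq> r" unfolding generated_iff by blast
    then show "\<exists>s\<in>P. s \<subseteq> p \<and> s \<subseteq> q" using r(3) by blast
  qed
next
  fix x assume x: "x \<in> generated P p"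
  then have "q \<in> generated P p" if "q \<in> P" "q \<subseteq> x" for q
    using that unfolding generated_iff by (meson order_trans)
  moreover have "x \<in> P" using x by (simp add: generated_iff)
  ultimately show "x \<in> regular_hull P (generated P p)"
    unfolding regular_hull_def by blast
qed

lemma generated_self: "p \<in> P \<Longrightarrow> p \<in> generated P p"
  unfolding generated_iff by blast

lemma generated_sub:
  assumes "U \<in> regular_open_algebra P" "p \<in> U"
  shows "generated P p \<subseteq> U"
proof
  fix x assume x: "x \<in> generated P p"
  show "x \<in> U"
  proof (rule regular_open_dense[OF assms(1)])
    show "x \<in> P" using x by (simp add: generated_iff)
    show "\<exists>r\<subseteq>q. r \<in> U" if q: "q \<in> P" "q \<subseteq> x" for q
    proof -
      obtain r where "r \<in> P" "r \<subseteq> p" "r \<subseteq> q" using x q unfolding generated_iff by blast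
      then show ?thesis using regular_open_down[OF assms] by blast
    qed
  qed
qed

section \<open>Distributivity\<close>

text \<open>Injections of each \<open>A n\<close> into \<open>Field \<nu>\<close>, applied
  coordinatewise, embed the sequences into the functions counted by
  \<open>\<nu> ^c natLeq\<close>.\<close>

lemma card_sequences_le_cexp:
  assumes "Card_order \<nu>" "\<And>n. |A n| \<le>o \<nu>"
  shows "|{h :: nat \<Rightarrow> 'v. \<forall>n. h n \<in> A n}| \<le>o \<nu> ^c natLeq"
proof -
  have "|A n| \<le>o |Field \<nu>|" for n
    using assms ordLeq_ordIso_trans[OF _ ordIso_symmetric[OF card_of_Field_ordIso]] by blast
  then have "\<exists>e. inj_on e (A n) \<and> e ` A n \<subseteq> Field \<nu>" for n
    by (simp add: card_of_ordLeq)
  then obtain e where e: "\<And>n. inj_on (e n) (A n)" "\<And>n. e n ` A n \<subseteq> Field \<nu>" by metis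
  define F where "F h n = e n (h n)" for h n
  have "inj_on F {h. \<forall>n. h n \<in> A n}"
  proof (rule inj_onI)
    fix h h' assume *: "h \<in> {h. \<forall>n. h n \<in> A n}" "h' \<in> {h. \<forall>n. h n \<in> A n}" "F h = F h'"
    have "h n = h' n" for n
    proof -
      have "F h n = F h' n" using *(3) by simp
      then show ?thesis using inj_onD[OF e(1), of n "h n" "h' n"] *(1,2) by (simp add: F_def)
    qed
    then show "h = h'" by blast
  qed
  moreover have "F ` {h. \<forall>n. h n \<in> A n} \<subseteq> Func (Field natLeq) (Field \<nu>)"
  proof -
    have "e n x \<in> Field \<nu>" if "x \<in> A n" for n x
      using e(2)[of n] that by blast
    then show ?thesis by (auto simp: F_def Func_def Field_natLeq)
  qed
  ultimately show ?thesis
    unfolding cexp_def card_of_ordLeq[symmetric] by blast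
qed

section \<open>Distributivity of the forcing and its completion, and absence of new
  sequences\<close>

context tree_forcing
begin

text \<open>For \<open>u\<close> in \<open>q\<close>, the cone at \<open>u\<close> contains a
  perfect tree inside \<open>w\<close>, and that tree still contains \<open>u\<close>.\<close>

lemma perfect_separative:
  assumes q: "perfect \<kappa> k q"
    and dense: "\<And>r. perfect \<kappa> k r \<Longrightarrow> r \<subseteq> q \<Longrightarrow> \<exists>r'\<subseteq>r. perfect \<kappa> k r' \<and> r' \<subseteq> w"
    and w: "perfect \<kappa> k w"
  shows "q \<subseteq> w"
proof
  fix u assume u: "u \<in> q"
  have "cone q u \<subseteq> q" by (auto simp: cone_def)
  then obtain r where r: "r \<subseteq> cone q u" "perfect \<kappa> k r" "r \<subseteq> w"
    using dense[OF perfect_cone[OF q u]] by blast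
  then show "u \<in> w"
    using perfect_sub_cone[OF r(2,1)] tree_node[OF perfect_tree[OF q] u] by blast
qed

context
  fixes \<nu> :: "'c rel" and e :: nat
  assumes \<nu>: "Card_order \<nu>" and small: "\<nu> ^c natLeq <o seg \<kappa> (k e)"
begin

lemma few_sequences:
  fixes A :: "nat \<Rightarrow> 'd set"
  assumes "\<And>n. |A n| \<le>o \<nu>"
  shows "|{h. \<forall>n. h n \<in> A n}| <o seg \<kappa> (k e)"
  using ordLeq_ordLess_trans[OF card_sequences_le_cexp[where A = A, OF \<nu> assms] small] .

text \<open>Here a decision is inclusion in a member of the antichain. Separativity upgrades the
  density of such decisions below \<open>q\<close> to inclusion of \<open>q\<close> itself.\<close>

lemma distributive_perfect_trees:
  "distributive_law (UNIV :: nat set) \<nu> (perfect_trees \<kappa> k)"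
proof (rule distributive_lawI)
  fix W and p assume W: "\<And>n::nat. n \<in> UNIV \<Longrightarrow> maximal_antichain (perfect_trees \<kappa> k) (W n) \<and> |W n| \<le>o \<nu>"
    and p: "p \<in> perfect_trees \<kappa> k"
  have WP: "perfect \<kappa> k w" if "w \<in> W n" for n w
    using maximal_antichain_sub[of "perfect_trees \<kappa> k" "W n"] W[OF UNIV_I, of n] that
    by (auto simp: perfect_trees_def)
  have dense: "\<exists>v\<in>W n. \<exists>S'\<subseteq>S. perfect \<kappa> k S' \<and> S' \<subseteq> v" if S: "perfect \<kappa> k S" for n S
  proof -
    obtain w r where "w \<in> W n" "r \<in> perfect_trees \<kappa> k" "r \<subseteq> S" "r \<subseteq> w"
      by (rule maximal_antichain_meets[of "perfect_trees \<kappa> k" "W n" S])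
        (use W[OF UNIV_I, of n] S in \<open>auto simp: perfect_trees_def\<close>)
    then show ?thesis by (auto simp: perfect_trees_def)
  qed
  obtain q h where q: "perfect \<kappa> k q" "q \<subseteq> p" and h: "\<And>n. h n \<in> W n"
    and below: "\<And>n r. perfect \<kappa> k r \<Longrightarrow> r \<subseteq> q \<Longrightarrow> \<exists>r'\<subseteq>r. perfect \<kappa> k r' \<and> r' \<subseteq> h n"
  proof (rule decide_sequence[of W e p "\<lambda>n v S. S \<subseteq> v"])
    show "|{h. \<forall>n. h n \<in> W n}| <o seg \<kappa> (k e)" using W by (intro few_sequences) blast
    show "perfect \<kappa> k p" using p by (simp add: perfect_trees_def)
    show "\<exists>v\<in>W n. \<exists>S'\<subseteq>S. perfect \<kappa> k S' \<and> S' \<subseteq> v" if "perfect \<kappa> k S" for n S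
      using that by (rule dense)
  qed (assumption | blast)+
  have "q \<subseteq> h n" for n
    using perfect_separative[OF q(1) below WP[OF h]] .
  then show "\<exists>q\<in>perfect_trees \<kappa> k. q \<subseteq> p \<and> (\<forall>n\<in>UNIV. \<exists>w\<in>W n. q \<subseteq> w)"
    using q h unfolding perfect_trees_def by blast
qed

text \<open>The decision is now membership of a tree in a regular open set. Regularity puts
  \<open>q\<close> itself into every \<open>h n\<close>, and the set generated by \<open>q\<close>
  is the required nonzero element.\<close>

lemma distributive_regular_open_algebra:
  "distributive_law (UNIV :: nat set) \<nu> (regular_open_algebra (perfect_trees \<kappa> k) - {{}})"
proof (rule distributive_lawI)
  let ?P = "perfect_trees \<kappa> k"
  let ?B = "regular_open_algebra ?P - {{}}"
  fix W and V assume W: "\<And>n::nat. n \<in> UNIV \<Longrightarrow> maximal_antichain ?B (W n) \<and> |W n| \<le>o \<nu>"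
    and V: "V \<in> ?B"
  obtain p where p: "p \<in> V" using V by blast
  then have pP: "p \<in> ?P" using V regular_open_sub[of V ?P] by blast
  have WB: "w \<in> regular_open_algebra ?P" if "w \<in> W n" for n w
    using maximal_antichain_sub[of ?B "W n"] W[OF UNIV_I, of n] that by blast
  have dense: "\<exists>v\<in>W n. \<exists>S'\<subseteq>S. perfect \<kappa> k S' \<and> S' \<in> v" if S: "perfect \<kappa> k S" for n S
  proof -
    have "S \<in> ?P" using S by (simp add: perfect_trees_def)
    then have "generated ?P S \<in> ?B"
      using generated_regular_open[of ?P S] generated_self[of S ?P] by blast
    then obtain v U where U: "v \<in> W n" "U \<in> ?B" "U \<subseteq> generated ?P S" "U \<subseteq> v"
      using maximal_antichain_meets[of ?B "W n" "generated ?P S"] W[OF UNIV_I, of n] by metis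
    then obtain x where x: "x \<in> U" by blast
    then have xP: "x \<in> ?P" using U regular_open_sub[of U ?P] by blast
    then obtain S' where "S' \<in> ?P" "S' \<subseteq> S" "S' \<subseteq> x"
      using x xP U(3) generated_iff[of x ?P S] by blast
    moreover have "S' \<in> v"
      using regular_open_down[OF WB[OF U(1)]] x U(4) calculation by blast
    ultimately show ?thesis using U(1) by (auto simp: perfect_trees_def)
  qed
  \<comment> \<open>Carrying \<open>v \<in> W n\<close> along records that \<open>v\<close> is
    regular open and hence closed downwards, so that decisions persist to smaller trees.\<close>
  have down: "S' \<in> v" if "S \<in> v \<and> v \<in> W n" "perfect \<kappa> k S'" "S' \<subseteq> S" for n v S S'
    using that regular_open_down[OF WB, of v n S S'] by (auto simp: perfect_trees_def)
  obtain q h where q: "perfect \<kappa> k q" "q \<subseteq> p" and h: "\<And>n. h n \<in> W n"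
    and below: "\<And>n r. perfect \<kappa> k r \<Longrightarrow> r \<subseteq> q \<Longrightarrow> \<exists>r'\<subseteq>r. perfect \<kappa> k r' \<and> (r' \<in> h n \<and> h n \<in> W n)"
  proof (rule decide_sequence[of W e p "\<lambda>n v S. S \<in> v \<and> v \<in> W n"])
    show "|{h. \<forall>n. h n \<in> W n}| <o seg \<kappa> (k e)" using W by (intro few_sequences) blast
    show "perfect \<kappa> k p" using pP by (simp add: perfect_trees_def)
    show "\<exists>v\<in>W n. \<exists>S'\<subseteq>S. perfect \<kappa> k S' \<and> S' \<in> v \<and> v \<in> W n" if "perfect \<kappa> k S" for n S
      using dense[OF that] by blast
    show "S' \<in> v \<and> v \<in> W n" if "S \<in> v \<and> v \<in> W n" "perfect \<kappa> k S'" "S' \<subseteq> S" for n v S S'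
      using down[OF that] that(1) by blast
  qed (assumption | blast)+
  have qP: "q \<in> ?P" using q by (simp add: perfect_trees_def)
  have "q \<in> h n" for n
  proof (rule regular_open_dense[OF WB[OF h] qP])
    fix r assume "r \<in> ?P" "r \<subseteq> q"
    then show "\<exists>r'\<subseteq>r. r' \<in> h n" using below[of r n] by (auto simp: perfect_trees_def)
  qed
  then have "generated ?P q \<subseteq> h n" for n
    using generated_sub[OF WB[OF h]] by blast
  moreover have "generated ?P q \<subseteq> V"
    using generated_sub[of V ?P q] V regular_open_down[of V ?P p q] p qP q(2) by blast
  moreover have "generated ?P q \<in> ?B"
    using generated_regular_open generated_self[OF qP] by blast
  ultimately show "\<exists>U\<in>?B. U \<subseteq> V \<and> (\<forall>n\<in>UNIV. \<exists>w\<in>W n. U \<subseteq> w)"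
    using h by blast
qed

lemma no_new_sequences:
  "adds_no_new_function (perfect_trees \<kappa> k) (UNIV :: nat set) (Field \<nu>)"
  unfolding adds_no_new_function_def
proof (intro allI ballI impI)
  let ?P = "perfect_trees \<kappa> k"
  fix F p assume p: "p \<in> ?P"
    and F: "F \<subseteq> ?P \<times> ((UNIV :: nat set) \<times> Field \<nu>) \<and> forces_function ?P UNIV (Field \<nu>) F p"
  have down: "forces_mem ?P F S' x" if "forces_mem ?P F S x" "S' \<subseteq> S" for S S' x
    unfolding forces_mem_def
  proof (intro ballI impI)
    fix q assume "q \<in> ?P" "q \<subseteq> S'"
    then show "\<exists>r\<in>?P. r \<subseteq> q \<and> (\<exists>s. (s, x) \<in> F \<and> r \<subseteq> s)"
      using that unfolding forces_mem_def by (meson subset_trans)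
  qed
  have dense: "\<exists>v\<in>Field \<nu>. \<exists>S'\<subseteq>S. perfect \<kappa> k S' \<and> forces_mem ?P F S' (n, v)"
    if S: "perfect \<kappa> k S" "S \<subseteq> p" for n S
  proof -
    have "S \<in> ?P" using S by (simp add: perfect_trees_def)
    then obtain S' v where "S' \<in> ?P" "S' \<subseteq> S" "v \<in> Field \<nu>" "forces_mem ?P F S' (n, v)"
      using F S(2) unfolding forces_function_def by (meson UNIV_I)
    then show ?thesis by (auto simp: perfect_trees_def)
  qed
  have card: "|Field \<nu>| \<le>o \<nu>"
    using card_of_Field_ordIso[OF \<nu>] ordIso_imp_ordLeq by blast
  obtain q h where q: "perfect \<kappa> k q" "q \<subseteq> p" and h: "\<And>n. h n \<in> Field \<nu>"
    and below: "\<And>n r. perfect \<kappa> k r \<Longrightarrow> r \<subseteq> q \<Longrightarrow> \<exists>r'\<subseteq>r. perfect \<kappa> k r' \<and> forces_mem ?P F r' (n, h n)"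
  proof (rule decide_sequence[of "\<lambda>_. Field \<nu>" e p "\<lambda>n v S. forces_mem ?P F S (n, v)"])
    show "|{h :: nat \<Rightarrow> 'c. \<forall>n. h n \<in> Field \<nu>}| <o seg \<kappa> (k e)"
      using card by (intro few_sequences)
    show "perfect \<kappa> k p" using p by (simp add: perfect_trees_def)
    show "\<exists>v\<in>Field \<nu>. \<exists>S'\<subseteq>S. perfect \<kappa> k S' \<and> forces_mem ?P F S' (n, v)"
      if "perfect \<kappa> k S" "S \<subseteq> p" for n S
      using that by (rule dense)
    show "forces_mem ?P F S' (n, v)" if "forces_mem ?P F S (n, v)" "S' \<subseteq> S" for n v S S'
      using that by (rule down)
  qed (assumption | blast)+
  \<comment> \<open>Forcing membership is a density condition, so it passes from densely many trees
    below \<open>q\<close> to \<open>q\<close>.\<close>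
  have "forces_mem ?P F q (n, h n)" for n
    unfolding forces_mem_def
  proof (intro ballI impI)
    fix r assume "r \<in> ?P" "r \<subseteq> q"
    then obtain r' where r': "r' \<subseteq> r" "r' \<in> ?P" "forces_mem ?P F r' (n, h n)"
      using below[of r n] by (auto simp: perfect_trees_def)
    then obtain r'' s where "r'' \<in> ?P" "r'' \<subseteq> r'" "(s, n, h n) \<in> F" "r'' \<subseteq> s"
      unfolding forces_mem_def by blast
    then show "\<exists>r'\<in>?P. r' \<subseteq> r \<and> (\<exists>s. (s, n, h n) \<in> F \<and> r' \<subseteq> s)"
      using r'(1) by blast
  qed
  then show "\<exists>q\<in>?P. q \<subseteq> p \<and> (\<exists>g. \<forall>n\<in>UNIV. g n \<in> Field \<nu> \<and> forces_mem ?P F q (n, g n))"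
    using q h unfolding perfect_trees_def by blast
qed

end

end

section \<open>Initial segments of a well-order and the choice of the stage\<close>

lemma Well_order_seg: "Well_order r \<Longrightarrow> Well_order (seg r a)"
  unfolding seg_def by (rule Well_order_Restr)

lemma seg_strict_mono: "Well_order r \<Longrightarrow> (a, b) \<in> r \<Longrightarrow> a \<noteq> b \<Longrightarrow> seg r a <o seg r b"
proof -
  assume r: "Well_order r" and ab: "(a, b) \<in> r" "a \<noteq> b"
  have "underS r a \<subset> underS r b"
    using ab r unfolding order_on_defs by (auto simp: underS_def dest: transD antisymD)
  then show ?thesis
    unfolding seg_def
    using r ofilter_subset_ordLess[of r "underS r a" "underS r b"] wo_rel.underS_ofilter[of r]
    by (simp add: wo_rel_def)
qed

lemma seg_mono:
  assumes "Well_order r" "(a, b) \<in> r"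
  shows "seg r a \<le>o seg r b"
proof (cases "a = b")
  case True
  then show ?thesis using ordLeq_reflexive[OF Well_order_seg[OF assms(1)]] by simp
next
  case False
  then show ?thesis using seg_strict_mono[OF assms] ordLess_imp_ordLeq by blast
qed

theorem theorem3p5:
  fixes \<kappa> :: "'a rel" and k :: "nat \<Rightarrow> 'a" and \<nu> :: "'a rel"
  assumes "singular_cardinal \<kappa>"
    and "has_cofinality \<kappa> natLeq"
    and "\<And>m n. m < n \<Longrightarrow> k m \<in> underS \<kappa> (k n)"
    and "\<And>n. k n \<in> Field \<kappa>"
    and "\<And>n. regular_cardinal (seg \<kappa> (k n))"
    and "\<And>n. natLeq <o seg \<kappa> (k n)"
    and "\<And>x. x \<in> Field \<kappa> \<Longrightarrow> \<exists>n. (x, k n) \<in> \<kappa>"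
    and "\<And>\<mu> :: 'a rel. Card_order \<mu> \<Longrightarrow> \<mu> <o \<kappa> \<Longrightarrow> \<mu> ^c natLeq <o \<kappa>"
    and "Card_order \<nu>" and "\<nu> <o \<kappa>"
  shows "distributive_law (UNIV :: nat set) \<nu> (perfect_trees \<kappa> k) \<and>
         distributive_law (UNIV :: nat set) \<nu> (regular_open_algebra (perfect_trees \<kappa> k) - {{}}) \<and>
         adds_no_new_function (perfect_trees \<kappa> k) (UNIV :: nat set) (Field \<nu>)"
proof -
  have wo: "Well_order \<kappa>"
    using assms(1) by (auto simp: singular_cardinal_def card_order_on_def)
  have "seg \<kappa> (k m) \<le>o seg \<kappa> (k n)" if "m \<le> n" for m n
  proof (cases "m = n")
    case True
    then show ?thesis using ordLeq_reflexive[OF Well_order_seg[OF wo]] by simp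
  next
    case False
    then have "(k m, k n) \<in> \<kappa>" using assms(3)[of m n] that by (auto simp: underS_def)
    then show ?thesis using seg_mono[OF wo] by blast
  qed
  then interpret tree_forcing \<kappa> k
    using assms(5) by unfold_locales
  have power: "\<nu> ^c natLeq <o \<kappa>" using assms(8-10) by blast
  \<comment> \<open>Being smaller than \<open>\<kappa>\<close>, the power is isomorphic to a proper
    initial segment, and the sequence \<open>k\<close> passes its endpoint \<open>a\<close>.\<close>
  then obtain a where a: "a \<in> Field \<kappa>" "\<nu> ^c natLeq =o seg \<kappa> a"
    using ordLess_iff_ordIso_Restr[OF wo, of "\<nu> ^c natLeq"] Card_order_cexp
    unfolding seg_def card_order_on_def by blast
  then obtain n where n: "(a, k n) \<in> \<kappa>" using assms(7) by blast
  \<comment> \<open>Reaching \<open>a\<close> gives only a weak inequality; one further index makes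
    it strict, and \<open>Suc n\<close> serves as \<open>e\<close>.\<close>
  have "seg \<kappa> (k n) <o seg \<kappa> (k (Suc n))"
    using seg_strict_mono[OF wo] assms(3)[of n "Suc n"] by (auto simp: underS_def)
  then have "\<nu> ^c natLeq <o seg \<kappa> (k (Suc n))"
    using a(2) seg_mono[OF wo n] ordIso_ordLeq_trans ordLeq_ordLess_trans by blast
  then show ?thesis
    using distributive_perfect_trees distributive_regular_open_algebra no_new_sequences assms(9)
    by blast
qed

end
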